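(* Let $i,k,j$ be non-negative integers such that $j\in \{0,1\}$ and $1\leq i\leq k+j-1$. Then, for all non-negative integers $n$, the three following sets of partitions are equinumerous: 1) the set of partitions of $n$ into parts not congruent to $0,\pm i \bmod (2k+j)$; 2) the set of partitions $(\lambda_1,\ldots)$ of $n$ with at most $i-1$ parts equal to $1$, and such that $\lambda_t-\lambda_{t+k-1}\geq 2$ for all $t\geq 1$, with the additional condition that if $\lambda_t-\lambda_{t+k-2}\leq 1$, then $$\lambda_t+\cdots+\lambda_{t+k-2}\equiv i-1 \bmod (2-j);$$ 3) the set of partitions $(\lambda_1,\ldots)$ such that $\lambda_t-\lambda_{t+2k+j-3}\geq 1$ for all $t\geq 1$, and $$n=\sum_{t\geq 1}\bigl(1+\chi(t\equiv i)+\chi(t\equiv 2k+j-i-1)\bigr)\lambda_t$$ with the congruences taken modulo $2k+j-2$.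
   Context: A partition is a finite non-increasing sequence of positive integers $(\lambda_1,\dots,\lambda_s)$ (its parts); it is a partition of $n$ if the parts sum to $n$. In 2) and 3), conditions on parts are imposed for those $t$ for which all the indices involved are indices of actual parts (no zero parts are added). $\chi(A)=1$ if $A$ is true and $0$ otherwise. *)

theory Defs
  imports "HOL-Number_Theory.Cong" "HOL-Library.Equipollence"
begin

definition is_partition :: "nat list \<Rightarrow> bool" where
  "is_partition xs \<longleftrightarrow> sorted_wrt (\<ge>) xs \<and> (\<forall>x \<in> set xs. 0 < x)"

(* Parts are numbered from 1; \<open>part xs t\<close> is meaningful only for \<open>t \<in> part_indices xs\<close>. *)
definition part_indices :: "nat list \<Rightarrow> nat set" where
  "part_indices xs = {1..length xs}"

definition part :: "nat list \<Rightarrow> nat \<Rightarrow> nat" where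
  "part xs t = xs ! (t - 1)"

(* For j \<le> 1 and 1 \<le> i \<le> k + j - 1, none of the natural-number subtractions below truncates;
   for the differences of parts this is because the parts are non-increasing. *)
definition congruence_partitions :: "nat \<Rightarrow> nat \<Rightarrow> nat \<Rightarrow> nat \<Rightarrow> nat list set" where
  "congruence_partitions i k j n =
     {xs. is_partition xs \<and> sum_list xs = n \<and>
          (\<forall>p \<in> set xs. \<not> [int p = 0] (mod int (2 * k + j)) \<and>
                        \<not> [int p = int i] (mod int (2 * k + j)) \<and>
                        \<not> [int p = - int i] (mod int (2 * k + j)))}"

(* If k = 1 then j = 1, so the last condition is a congruence modulo 1 and imposes nothing. *)
definition difference_partitions :: "nat \<Rightarrow> nat \<Rightarrow> nat \<Rightarrow> nat \<Rightarrow> nat list set" where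
  "difference_partitions i k j n =
     {xs. is_partition xs \<and> sum_list xs = n \<and>
          count_list xs 1 \<le> i - 1 \<and>
          (\<forall>t. t \<in> part_indices xs \<and> t + k - 1 \<in> part_indices xs \<longrightarrow>
               part xs t - part xs (t + k - 1) \<ge> 2) \<and>
          (\<forall>t. t \<in> part_indices xs \<and> t + k - 2 \<in> part_indices xs \<longrightarrow>
               part xs t - part xs (t + k - 2) \<le> 1 \<longrightarrow>
               [(\<Sum>s = t..t + k - 2. part xs s) = i - 1] (mod (2 - j)))}"

definition weighted_partitions :: "nat \<Rightarrow> nat \<Rightarrow> nat \<Rightarrow> nat \<Rightarrow> nat list set" where
  "weighted_partitions i k j n =
     {xs. is_partition xs \<and>
          (\<forall>t. t \<in> part_indices xs \<and> t + 2 * k + j - 3 \<in> part_indices xs \<longrightarrow>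
               part xs t - part xs (t + 2 * k + j - 3) \<ge> 1) \<and>
          n = (\<Sum>t \<in> part_indices xs.
                 (1 + of_bool ([t = i] (mod (2 * k + j - 2)))
                    + of_bool ([t = 2 * k + j - i - 1] (mod (2 * k + j - 2)))) * part xs t)}"

end

(* Set 1 and set 2. Write P for the product of all 1 - q^m. The generating function D(s,i) of the
   partitions with all parts > s satisfying the difference condition, with fewer than i parts s+1,
   satisfies a linear recursion in (s,i) obtained by deleting the parts equal to s+1, and D(s,i) -> 1
   as s grows; so the recursion determines D. With N = 2k+j and d = 2-j, it is also solved, for those
   (s,i) whose parity agrees with the residue condition when d = 2, by 1/P times the alternating series
   with general term
     (-1)^n q^(s(k+j-1)n + N n(n+1)/2 - i n) (1 - q^(i(s+2n+1))) prod_{n<m<=n+s} (1 - q^(d m)),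
   divided by prod_{m<=s} (1+q^m) when d = 2. For d = 1 this is Andrews' function J_{k,i}(x) at x = q^s.
   At s = 0 the Jacobi triple product sums the series.
   Everything is computed modulo q^(L+1) for fixed L, so all sums and products are finite.

   Set 1 and set 3. The conjugate of a partition in set 3, with each part m replaced by the sum of the
   first m weights, is an arbitrary partition of n into parts not congruent to i or -i modulo N with all
   gaps, including the smallest part, less than N. By a theorem of Stockhofe such partitions correspond
   to those without multiples of N, preserving the word of nonzero residues: for a fixed word of length r
   both generating functions are q^c / ((1 - q^N) ... (1 - q^(N r))), where c is
   the least sum of a partition with that residue word. *)

theory Submission
  imports Defs "HOL-Computational_Algebra.Formal_Power_Series"
begin

section \<open>Power series modulo a power of X, and generating functions\<close>

text \<open>For d = 2 the bound on the number of parts s+2 depends on a parity, so the recursion is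
  not uniform over all (s,i). On the pairs with i + s(k-1) = e+1 (mod 2), two consecutive
  multiplicities of s+1, namely i-2 and i-1, lead to the same bound. Together they contribute
  q^((s+1)(i-2)) (1 + q^(s+1)) D(s+1, k+1-i). This explains both the step 2 in i and the factors 1 +
  q^m. The parity class is closed under the recursion and contains the wanted pair s = 0, i = e+1.
  The series obeys the same recursion because its defect, taken term by term, is a difference of
  consecutive values of an explicit sequence that vanishes at both ends up to the precision used. In
  the comparison of residue words, a multiple of N is a letter 0 inserted into the word of nonzero
  residues. After a nonzero letter it forces a passage to the next multiple of N, so deleting the
  first letter changes the level at which the rest starts. The level is therefore a free parameter
  in the induction.\<close>

definition eq_upto :: "nat \<Rightarrow> int fps \<Rightarrow> int fps \<Rightarrow> bool" where
  "eq_upto L f g \<longleftrightarrow> fps_X ^ Suc L dvd f - g"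

lemma eq_upto_refl [simp]: "eq_upto L f f"
  by (simp add: eq_upto_def)

lemma eq_upto_sym: "eq_upto L f g \<Longrightarrow> eq_upto L g f"
  unfolding eq_upto_def by (subst dvd_minus_iff[symmetric]) simp

lemma eq_upto_trans [trans]: assumes "eq_upto L f g" "eq_upto L g h" shows "eq_upto L f h"
proof -
  have "f - h = (f - g) + (g - h)" by simp
  then show ?thesis using assms unfolding eq_upto_def by (simp only: dvd_add)
qed

lemma eq_upto_add: assumes "eq_upto L f g" "eq_upto L f' g'" shows "eq_upto L (f + f') (g + g')"
proof -
  have "f + f' - (g + g') = (f - g) + (f' - g')" by simp
  then show ?thesis using assms unfolding eq_upto_def by (simp only: dvd_add)
qed

lemma eq_upto_diff: assumes "eq_upto L f g" "eq_upto L f' g'" shows "eq_upto L (f - f') (g - g')"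
proof -
  have "f - f' - (g - g') = (f - g) - (f' - g')" by simp
  then show ?thesis using assms unfolding eq_upto_def by (simp only: dvd_diff)
qed

lemma eq_upto_mult: assumes "eq_upto L f g" "eq_upto L f' g'" shows "eq_upto L (f * f') (g * g')"
proof -
  have "f * f' - g * g' = f * (f' - g') + (f - g) * g'" by (simp add: algebra_simps)
  then show ?thesis using assms unfolding eq_upto_def by (simp only: dvd_add dvd_mult dvd_mult2)
qed

lemma eq_upto_mult_left: "eq_upto L f g \<Longrightarrow> eq_upto L (h * f) (h * g)"
  by (simp add: eq_upto_mult)

lemma eq_upto_sum: "(\<And>x. x \<in> A \<Longrightarrow> eq_upto L (f x) (g x)) \<Longrightarrow> eq_upto L (sum f A) (sum g A)"
  by (induction A rule: infinite_finite_induct) (auto intro: eq_upto_add)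

lemma eq_upto_prod: "(\<And>x. x \<in> A \<Longrightarrow> eq_upto L (f x) (g x)) \<Longrightarrow> eq_upto L (prod f A) (prod g A)"
  by (induction A rule: infinite_finite_induct) (auto intro: eq_upto_mult)

lemma eq_upto_X_power_0: "L < e \<Longrightarrow> eq_upto L (h * fps_X ^ e) 0"
  unfolding eq_upto_def diff_0_right by (intro dvd_mult le_imp_power_dvd Suc_leI)

lemma eq_upto_1_minus_X: "L < e \<Longrightarrow> eq_upto L (1 - fps_X ^ e) 1"
  using eq_upto_diff[OF eq_upto_refl eq_upto_X_power_0[of L e 1], of 1] by simp

lemma eq_upto_iff: "eq_upto L f g \<longleftrightarrow> (\<forall>n\<le>L. fps_nth f n = fps_nth g n)"
proof
  assume "eq_upto L f g"
  then obtain h where "f - g = fps_X ^ Suc L * h" unfolding eq_upto_def by (elim dvdE)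
  then have "fps_nth (f - g) n = 0" if "n \<le> L" for n
    using that by (simp only: fps_X_power_mult_nth) simp
  then show "\<forall>n\<le>L. fps_nth f n = fps_nth g n" by simp
next
  assume *: "\<forall>n\<le>L. fps_nth f n = fps_nth g n"
  have "f - g = fps_X ^ Suc L * fps_shift (Suc L) (f - g)"
    using * by (intro fps_ext) (simp only: fps_X_power_mult_nth fps_sub_nth fps_shift_nth, auto)
  then show "eq_upto L f g" unfolding eq_upto_def by (metis dvd_triv_left)
qed

lemma eq_upto_cancel:
  assumes "fps_nth u 0 = 1" and "eq_upto L (u * f) (u * g)" shows "eq_upto L f g"
proof -
  define v where "v = fps_right_inverse u 1"
  have "u * v = 1" unfolding v_def by (rule fps_right_inverse) (simp add: assms)
  then have *: "v * (u * h) = h" for h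
    by (metis mult.assoc mult.commute mult_1)
  from eq_upto_mult_left[OF assms(2), of v] show ?thesis unfolding * .
qed

section \<open>Generating functions of weighted sets\<close>

definition gf :: "('a \<Rightarrow> nat) \<Rightarrow> 'a set \<Rightarrow> int fps" where
  "gf wt S = Abs_fps (\<lambda>n. int (card {x \<in> S. wt x = n}))"

text \<open>Since \<open>card\<close> is 0 on infinite sets, \<open>gf\<close> is additive over
  disjoint unions only under a finiteness condition on the fibres.\<close>

definition finite_fibers :: "('a \<Rightarrow> nat) \<Rightarrow> 'a set \<Rightarrow> bool" where
  "finite_fibers wt S \<longleftrightarrow> (\<forall>n. finite {x \<in> S. wt x = n})"

lemma finite_fibers_subset: "finite_fibers wt S \<Longrightarrow> T \<subseteq> S \<Longrightarrow> finite_fibers wt T"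
  unfolding finite_fibers_def by (auto intro: rev_finite_subset)

lemma gf_Un:
  assumes "finite_fibers wt S" "finite_fibers wt T" "S \<inter> T = {}"
  shows "gf wt (S \<union> T) = gf wt S + gf wt T"
proof (rule fps_ext)
  fix n
  have "{x \<in> S \<union> T. wt x = n} = {x \<in> S. wt x = n} \<union> {x \<in> T. wt x = n}" by auto
  moreover have "card \<dots> = card {x \<in> S. wt x = n} + card {x \<in> T. wt x = n}"
    using assms by (intro card_Un_disjoint) (auto simp: finite_fibers_def)
  ultimately show "fps_nth (gf wt (S \<union> T)) n = fps_nth (gf wt S + gf wt T) n"
    by (simp add: gf_def)
qed

lemma gf_shift:
  assumes "inj_on h S" "\<And>x. x \<in> S \<Longrightarrow> wt (h x) = wt' x + c"
  shows "gf wt (h ` S) = fps_X ^ c * gf wt' S"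
proof (rule fps_ext)
  fix n
  show "fps_nth (gf wt (h ` S)) n = fps_nth (fps_X ^ c * gf wt' S) n"
  proof (cases "n < c")
    case True
    then have "{x \<in> h ` S. wt x = n} = {}" using assms(2) by auto
    then show ?thesis using True by (simp only: fps_X_power_mult_nth gf_def fps_nth_Abs_fps card.empty) simp
  next
    case False
    then have "{x \<in> h ` S. wt x = n} = h ` {x \<in> S. wt' x = n - c}"
      using assms(2) by (auto intro!: imageI)
    moreover have "card \<dots> = card {x \<in> S. wt' x = n - c}"
      by (intro card_image inj_on_subset[OF assms(1)]) auto
    ultimately show ?thesis using False by (simp only: fps_X_power_mult_nth) (simp add: gf_def)
  qed
qed

lemma gf_empty [simp]: "gf wt {} = 0"
  by (simp add: gf_def fps_eq_iff)

lemma length_le_sum_list: "\<forall>x\<in>set xs. 0 < x \<Longrightarrow> length xs \<le> sum_list (xs :: nat list)"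
  by (induction xs) auto

lemma finite_lists_sum: "finite {xs :: nat list. (\<forall>x\<in>set xs. 0 < x) \<and> sum_list xs = n}"
proof (rule finite_subset)
  show "{xs. (\<forall>x\<in>set xs. 0 < x) \<and> sum_list xs = n} \<subseteq> {xs. set xs \<subseteq> {..n} \<and> length xs \<le> n}"
    by (auto intro: member_le_sum_list length_le_sum_list)
  show "finite {xs. set xs \<subseteq> {..n} \<and> length xs \<le> n}"
    by (rule finite_lists_length_le) simp
qed

lemma finite_fibers_lists:
  fixes wt :: "nat list \<Rightarrow> nat"
  assumes "\<And>xs. xs \<in> S \<Longrightarrow> (\<forall>x\<in>set xs. 0 < x) \<and> sum_list xs \<le> wt xs"
  shows "finite_fibers wt S"
  unfolding finite_fibers_def
proof
  fix n
  have "{x \<in> S. wt x = n} \<subseteq> (\<Union>m\<in>{..n}. {xs. (\<forall>x\<in>set xs. 0 < x) \<and> sum_list xs = m})"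
    using assms by auto
  then show "finite {x \<in> S. wt x = n}"
    by (rule finite_subset) (intro finite_UN_I finite_lists_sum finite_atMost)
qed

section \<open>The Jacobi triple product\<close>

text \<open>Exponent N r(r+1)/2 - i r of the theta series at r = n; \<open>thexp_neg\<close> takes r
  = -n. Both are partial sums of the exponents in the factors 1 - q^(N(m+1)-i) and 1 - q^(N m + i),
  which avoids halving and keeps the numbers natural.\<close>

definition thexp_pos :: "nat \<Rightarrow> nat \<Rightarrow> nat \<Rightarrow> nat" where
  "thexp_pos N i n = (\<Sum>m<n. N * Suc m - i)"

definition thexp_neg :: "nat \<Rightarrow> nat \<Rightarrow> nat \<Rightarrow> nat" where
  "thexp_neg N i n = (\<Sum>m<n. N * m + i)"

text \<open>The coefficient of index \<open>r - b\<close>, possibly negative, of the theta series.\<close>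

definition thcoef :: "nat \<Rightarrow> nat \<Rightarrow> nat \<Rightarrow> nat \<Rightarrow> int fps" where
  "thcoef N i b r = (if b \<le> r then (- 1) ^ (r - b) * fps_X ^ thexp_pos N i (r - b)
                     else (- 1) ^ (b - r) * fps_X ^ thexp_neg N i (b - r))"

lemma thcoef_Suc_Suc: "thcoef N i (Suc b) (Suc r) = thcoef N i b r"
  by (simp add: thcoef_def)

lemma thcoef_Suc_0: "thcoef N i (Suc b) 0 = - (fps_X ^ (N * b + i) * thcoef N i b 0)"
  by (cases b) (auto simp: thcoef_def thexp_neg_def thexp_pos_def power_add mult_ac)

lemma thcoef_0_Suc: "thcoef N i 0 (Suc r) = - (fps_X ^ (N * Suc r - i) * thcoef N i 0 r)"
  by (simp add: thcoef_def thexp_pos_def power_add mult_ac)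

text \<open>Theta coefficients of indices n = r - b and n + 1 have ratio -q^(N(n+1)-i), whose
  exponent may be negative. The factor q^(N b + i) turns it into N(r+1).\<close>

lemma thcoef_rec:
  assumes "i < N"
  shows "fps_X ^ (N * b + i) * thcoef N i b (Suc r) = - (fps_X ^ (N * Suc r) * thcoef N i b r)"
proof (induction b arbitrary: r)
  case 0
  have "i + (N * Suc r - i) = N * Suc r" using assms by (simp add: trans_le_add1)
  then have "fps_X ^ i * fps_X ^ (N * Suc r - i) = (fps_X ^ (N * Suc r) :: int fps)"
    by (simp only: power_add[symmetric])
  then show ?case
    by (simp add: thcoef_0_Suc mult.assoc[symmetric] del: mult_Suc_right)
next
  case (Suc b)
  show ?case
  proof (cases r)
    case 0
    then show ?thesis
      by (simp add: thcoef_Suc_Suc thcoef_Suc_0 power_add mult_ac)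
  next
    case (Suc r')
    then show ?thesis using Suc.IH[of r']
      by (simp add: thcoef_Suc_Suc power_add mult_ac)
  qed
qed

text \<open>With (r)! short for the product of 1 - q^(N m) over 0 < m <= r, this is (R)!/(r)!: the
  denominators of Euler's series, cleared by a common factor.\<close>

definition ptail :: "nat \<Rightarrow> nat \<Rightarrow> nat \<Rightarrow> int fps" where
  "ptail N R r = (\<Prod>m\<in>{r<..R}. 1 - fps_X ^ (N * m))"

lemma ptail_self [simp]: "ptail N R R = 1"
  by (simp add: ptail_def)

lemma ptail_step: assumes "r < R"
  shows "ptail N R r = (1 - fps_X ^ (N * Suc r)) * ptail N R (Suc r)"
proof -
  have "{r<..R} = insert (Suc r) {Suc r<..R}" using assms by auto
  then show ?thesis by (simp add: ptail_def)
qed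

text \<open>Moving the lower end of the summation range from \<open>- b\<close> to \<open>- b - 1\<close> produces one more
  factor of the product; the last term is the truncation error.\<close>

lemma theta_step_neg:
  assumes "i < N" "0 < R"
  shows "(\<Sum>r\<le>R. thcoef N i (Suc b) r * ptail N R r) =
         (1 - fps_X ^ (N * b + i)) * (\<Sum>r\<le>R. thcoef N i b r * ptail N R r) - thcoef N i b R"
proof -
  let ?d = "thcoef N i b" and ?T = "ptail N R" and ?z = "fps_X ^ (N * b + i) :: int fps"
  obtain R' where R: "R = Suc R'" using assms by (cases R) auto
  have "(\<Sum>r\<le>R. thcoef N i (Suc b) r * ?T r)
      = - (?z * ?d 0 * ?T 0) + (\<Sum>r\<le>R'. ?d r * ?T (Suc r))"
    by (simp add: R sum.atMost_Suc_shift thcoef_Suc_Suc thcoef_Suc_0 del: sum.atMost_Suc)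
  also have "(\<Sum>r\<le>R'. ?d r * ?T (Suc r))
      = (\<Sum>r\<le>R'. ?d r * ?T r - ?z * (?d (Suc r) * ?T (Suc r)))"
  proof (rule sum.cong)
    fix r assume "r \<in> {..R'}"
    then have "ptail N R r = (1 - fps_X ^ (N * Suc r)) * ptail N R (Suc r)"
      using R by (intro ptail_step) simp
    \<comment> \<open>The part with q^(N(r+1)) is split off because \<open>thcoef_rec\<close> turns
      it into a term of the original sum at r + 1.\<close>
    then have "?d r * ?T (Suc r) = ?d r * ?T r + (fps_X ^ (N * Suc r) * ?d r) * ?T (Suc r)"
      by (simp only:) (simp add: left_diff_distrib right_diff_distrib mult_ac del: mult_Suc_right)
    also have "fps_X ^ (N * Suc r) * ?d r = - (?z * ?d (Suc r))"
      using thcoef_rec[OF assms(1), of b r] by simp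
    finally show "?d r * ?T (Suc r) = ?d r * ?T r - ?z * (?d (Suc r) * ?T (Suc r))"
      by (simp add: mult.assoc)
  qed simp
  also have "\<dots> = (\<Sum>r\<le>R'. ?d r * ?T r) - ?z * (\<Sum>r\<le>R'. ?d (Suc r) * ?T (Suc r))"
    by (simp add: sum_subtractf sum_distrib_left)
  also have "(\<Sum>r\<le>R'. ?d r * ?T r) = (\<Sum>r\<le>R. ?d r * ?T r) - ?d R"
    by (simp add: R)
  also have "(\<Sum>r\<le>R'. ?d (Suc r) * ?T (Suc r)) = (\<Sum>r\<le>R. ?d r * ?T r) - ?d 0 * ?T 0"
    by (simp add: R sum.atMost_Suc_shift del: sum.atMost_Suc)
  finally show ?thesis by (simp add: algebra_simps)
qed

text \<open>The functional equation of Euler's series: replacing a by a + 1 extracts one factor of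
  the product, because q^(N r) relates the two sums termwise and 1 - q^(N r) shifts
  \<open>ptail\<close>. The last term is the truncation error.\<close>

lemma theta_step_pos:
  assumes "i < N"
  shows "(\<Sum>r\<le>R. fps_X ^ (N * a * r) * thcoef N i 0 r * ptail N R r) =
         (1 - fps_X ^ (N * Suc a - i)) *
           (\<Sum>r\<le>R. fps_X ^ (N * Suc a * r) * thcoef N i 0 r * ptail N R r)
         - fps_X ^ (N * a * Suc R) * thcoef N i 0 (Suc R)"
proof -
  let ?d = "thcoef N i 0" and ?T = "ptail N R" and ?z = "fps_X ^ (N * Suc a - i) :: int fps"
  let ?g = "\<lambda>r. fps_X ^ (N * a * r) * ?d r"
  let ?h = "\<lambda>r. fps_X ^ (N * Suc a * r) * ?d r"
  have zh: "?z * ?h r = - ?g (Suc r)" for r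
  proof -
    have "i \<le> N * Suc a" "i \<le> N * Suc r" using assms by (simp_all add: trans_le_add1)
    then have "N * Suc a - i + N * Suc a * r = N * a * Suc r + (N * Suc r - i)"
      by (simp add: algebra_simps)
    then show ?thesis
      by (simp add: thcoef_0_Suc mult.assoc[symmetric] power_add[symmetric] del: mult_Suc_right mult_Suc)
  qed
  have "?z * (\<Sum>r\<le>R. ?h r * ?T r) = (\<Sum>r\<le>R. - (?g (Suc r) * ?T r))"
    unfolding sum_distrib_left
  proof (rule sum.cong)
    fix r
    have "?z * (?h r * ?T r) = (?z * ?h r) * ?T r" by (simp only: mult.assoc)
    then show "?z * (?h r * ?T r) = - (?g (Suc r) * ?T r)" by (simp only: zh mult_minus_left)
  qed simp
  also have "\<dots> = - (\<Sum>r<R. ?g (Suc r) * ?T r) - ?g (Suc R)"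
    by (simp add: lessThan_Suc_atMost[symmetric] sum_negf)
  also have "(\<Sum>r<R. ?g (Suc r) * ?T r) = (\<Sum>r<R. ?g (Suc r) * (1 - fps_X ^ (N * Suc r)) * ?T (Suc r))"
    by (rule sum.cong) (simp_all add: ptail_step mult.assoc del: mult_Suc_right)
  also have "\<dots> = (\<Sum>r\<le>R. ?g r * (1 - fps_X ^ (N * r)) * ?T r)"
    unfolding lessThan_Suc_atMost[symmetric] by (subst sum.lessThan_Suc_shift) simp
  also have "\<dots> = (\<Sum>r\<le>R. ?g r * ?T r) - (\<Sum>r\<le>R. ?h r * ?T r)"
    unfolding sum_subtractf[symmetric]
    by (rule sum.cong) (simp_all add: algebra_simps power_add)
  finally show ?thesis by (simp add: algebra_simps)
qed

text \<open>A factor X^e raises the precision, so f and g need to agree only to the lower order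
  M.\<close>

lemma eq_upto_X_mult: assumes "eq_upto M f g" "L \<le> e + M" shows "eq_upto L (fps_X ^ e * f) (fps_X ^ e * g)"
proof -
  have "fps_X ^ e * fps_X ^ Suc M dvd fps_X ^ e * (f - g)"
    using assms(1) unfolding eq_upto_def by (rule mult_dvd_mono[OF dvd_refl])
  moreover have "fps_X ^ Suc L dvd (fps_X ^ e * fps_X ^ Suc M :: int fps)"
    unfolding power_add[symmetric] using assms(2) by (intro le_imp_power_dvd) simp
  ultimately show ?thesis
    unfolding eq_upto_def right_diff_distrib[symmetric] by (rule dvd_trans[rotated])
qed

lemma eq_upto_prod_1:
  assumes "\<And>x. x \<in> A \<Longrightarrow> L < e x"
  shows "eq_upto L (\<Prod>x\<in>A. 1 - fps_X ^ e x) 1"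
  using eq_upto_prod[of A L "\<lambda>x. 1 - fps_X ^ e x" "\<lambda>_. 1"] assms by (simp add: eq_upto_1_minus_X)

lemma eq_upto_prod_restrict:
  assumes "finite A"
  shows "eq_upto L (\<Prod>m\<in>A. 1 - fps_X ^ m) (\<Prod>m\<in>A \<inter> {..L}. 1 - fps_X ^ m)"
proof -
  have "(\<Prod>m\<in>A. 1 - fps_X ^ m :: int fps) = (\<Prod>m\<in>A \<inter> {..L}. 1 - fps_X ^ m) * (\<Prod>m\<in>A - {..L}. 1 - fps_X ^ m)"
    using assms by (rule prod.Int_Diff)
  moreover have "eq_upto L (\<Prod>m\<in>A - {..L}. 1 - fps_X ^ m) 1"
    by (rule eq_upto_prod_1) auto
  ultimately show ?thesis using eq_upto_mult_left by fastforce
qed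

lemma thexp_pos_ge: "i < N \<Longrightarrow> n \<le> thexp_pos N i n"
proof (induction n)
  case (Suc n)
  have "N \<le> N * Suc n" by simp
  with Suc.prems have "1 \<le> N * Suc n - i" by linarith
  with Suc show ?case by (simp add: thexp_pos_def)
qed simp

lemma thcoef_eq_0:
  assumes "i < N" "L + b < r"
  shows "eq_upto L (h * thcoef N i b r) 0"
proof -
  have "L < thexp_pos N i (r - b)" using thexp_pos_ge[OF assms(1), of "r - b"] assms(2) by linarith
  from eq_upto_X_power_0[OF this, of "h * (- 1) ^ (r - b)"] show ?thesis
    using assms(2) by (simp add: thcoef_def mult.assoc)
qed

text \<open>\<open>L + b \<le> R\<close> pushes every truncation error of
  \<open>theta_step_neg\<close> beyond degree L: the index R - b' exceeds L for each b' < b.\<close>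

lemma theta_neg:
  assumes "i < N" "L + b \<le> R" "0 < R"
  shows "eq_upto L (\<Sum>r\<le>R. thcoef N i b r * ptail N R r)
     ((\<Prod>m<b. 1 - fps_X ^ (N * m + i)) * (\<Sum>r\<le>R. thcoef N i 0 r * ptail N R r))"
  using assms(2)
proof (induction b)
  case (Suc b)
  let ?S = "\<lambda>b. \<Sum>r\<le>R. thcoef N i b r * ptail N R r"
  have "eq_upto L (?S (Suc b)) ((1 - fps_X ^ (N * b + i)) * ?S b - 0)"
    unfolding theta_step_neg[OF assms(1,3)]
    using thcoef_eq_0[OF assms(1), of L b R 1] Suc.prems by (intro eq_upto_diff) simp_all
  also have "eq_upto L \<dots> ((1 - fps_X ^ (N * b + i)) * ((\<Prod>m<b. 1 - fps_X ^ (N * m + i)) * ?S 0) - 0)"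
    using Suc by (intro eq_upto_diff eq_upto_mult_left) simp_all
  also have "\<dots> = (\<Prod>m<Suc b. 1 - fps_X ^ (N * m + i)) * ?S 0"
    by (simp add: mult_ac)
  finally show ?case .
qed simp

lemma theta_pos:
  assumes "i < N" "L \<le> R"
  shows "eq_upto L (\<Sum>r\<le>R. thcoef N i 0 r * ptail N R r)
     ((\<Prod>m<a. 1 - fps_X ^ (N * Suc m - i)) * (\<Sum>r\<le>R. fps_X ^ (N * a * r) * thcoef N i 0 r * ptail N R r))"
proof (induction a)
  case (Suc a)
  let ?S = "\<lambda>a. \<Sum>r\<le>R. fps_X ^ (N * a * r) * thcoef N i 0 r * ptail N R r"
  let ?P = "\<Prod>m<a. 1 - fps_X ^ (N * Suc m - i) :: int fps"
  have "eq_upto L (\<Sum>r\<le>R. thcoef N i 0 r * ptail N R r) (?P * ?S a)" by (rule Suc.IH)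
  also have "eq_upto L \<dots> (?P * ((1 - fps_X ^ (N * Suc a - i)) * ?S (Suc a) - 0))"
    unfolding theta_step_pos[OF assms(1), of a R]
    using assms by (intro eq_upto_diff eq_upto_mult_left thcoef_eq_0) simp_all
  also have "\<dots> = (\<Prod>m<Suc a. 1 - fps_X ^ (N * Suc m - i)) * ?S (Suc a)"
    by (simp only: prod.lessThan_Suc diff_0_right mult.assoc)
  finally show ?case .
qed simp

text \<open>At a = L each term with r > 0 has degree at least L + r, so only r = 0 survives.\<close>

lemma theta_pos_limit:
  assumes "i < N"
  shows "eq_upto L (\<Sum>r\<le>R. fps_X ^ (N * L * r) * thcoef N i 0 r * ptail N R r) (ptail N R 0)"
proof -
  have "eq_upto L (\<Sum>r\<le>R. fps_X ^ (N * L * r) * thcoef N i 0 r * ptail N R r)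
      (\<Sum>r\<le>R. if r = 0 then ptail N R 0 else 0)"
  proof (rule eq_upto_sum)
    fix r
    show "eq_upto L (fps_X ^ (N * L * r) * thcoef N i 0 r * ptail N R r) (if r = 0 then ptail N R 0 else 0)"
    proof (cases r)
      case 0
      then show ?thesis by (simp add: thcoef_def thexp_pos_def)
    next
      case (Suc r')
      have "L \<le> N * L * Suc r'" using assms by (cases N) auto
      moreover have "Suc r' \<le> thexp_pos N i (Suc r')" using thexp_pos_ge[OF assms] .
      ultimately have "L + Suc r' \<le> N * L * Suc r' + thexp_pos N i (Suc r')" by (rule add_mono)
      then have "L < N * L * r + thexp_pos N i r" unfolding Suc by (rule less_le_trans[rotated]) simp
      from eq_upto_X_power_0[OF this, of "(- 1) ^ r * ptail N R r"] Suc
      show ?thesis by (simp only: thcoef_def power_add) (simp add: mult_ac)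
    qed
  qed
  then show ?thesis by simp
qed

text \<open>For r > L all factors of \<open>ptail\<close> are already 1 to this order. For r <= L,
  \<open>ptail\<close> differs from 1 only from degree N(r+1) on, and the coefficient contributes at
  least N(L-r); the total N(L+1) exceeds L.\<close>

lemma theta_neg_limit:
  assumes "i < N"
  shows "eq_upto L (\<Sum>r\<le>R. thcoef N i (Suc L) r * ptail N R r) (\<Sum>r\<le>R. thcoef N i (Suc L) r)"
proof (rule eq_upto_sum)
  fix r
  show "eq_upto L (thcoef N i (Suc L) r * ptail N R r) (thcoef N i (Suc L) r)"
  proof (cases "Suc L \<le> r")
    case True
    have "L < N * m" if "r < m" for m
    proof -
      have "m \<le> N * m" using assms by (cases N) auto
      then show ?thesis using that True by linarith
    qed
    then have "eq_upto L (ptail N R r) 1" unfolding ptail_def by (intro eq_upto_prod_1) auto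
    from eq_upto_mult_left[OF this] show ?thesis by simp
  next
    case False
    define m where "m = L - r"
    have m: "Suc L - r = Suc m" using False by (simp add: m_def)
    have "N * Suc r - 1 < N * k" if "r < k" for k
    proof -
      have "N * Suc r \<le> N * k" using that by (intro mult_le_mono) auto
      moreover have "0 < N * Suc r" using assms by simp
      ultimately show ?thesis by linarith
    qed
    then have "eq_upto (N * Suc r - 1) (ptail N R r) 1"
      unfolding ptail_def by (intro eq_upto_prod_1) auto
    moreover have "L \<le> thexp_neg N i (Suc m) + (N * Suc r - 1)"
    proof -
      have "N * m \<le> thexp_neg N i (Suc m)" by (simp add: thexp_neg_def)
      moreover have "N * m + N * Suc r = N * Suc L"
        unfolding distrib_left[symmetric] using False by (simp add: m_def)
      moreover have "Suc L \<le> N * Suc L" "N * Suc r \<noteq> 0" using assms by (cases N; simp)+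
      ultimately show ?thesis by linarith
    qed
    ultimately have "eq_upto L (fps_X ^ thexp_neg N i (Suc m) * ptail N R r) (fps_X ^ thexp_neg N i (Suc m) * 1)"
      by (rule eq_upto_X_mult)
    from eq_upto_mult_left[OF this, of "(- 1) ^ Suc m"] show ?thesis
      using False by (simp add: thcoef_def m mult.assoc)
  qed
qed

lemma sum_lessThan_add:
  fixes f :: "nat \<Rightarrow> 'a :: comm_monoid_add"
  shows "(\<Sum>r<m + n. f r) = (\<Sum>r<m. f r) + (\<Sum>r<n. f (m + r))"
  by (induction n) (simp_all add: add.assoc)

text \<open>The indices r - (L+1) run from -(L+1) to L, so n is paired with -(n+1).\<close>

lemma thcoef_sum:
  "(\<Sum>r\<le>2 * L + 1. thcoef N i (Suc L) r) =
   (\<Sum>n<Suc L. (- 1) ^ n * (fps_X ^ thexp_pos N i n - fps_X ^ thexp_neg N i (Suc n)))"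
proof -
  have "(\<Sum>r\<le>2 * L + 1. thcoef N i (Suc L) r) = (\<Sum>r<Suc L + Suc L. thcoef N i (Suc L) r)"
    by (rule sum.cong) auto
  also have "\<dots> = (\<Sum>r<Suc L. thcoef N i (Suc L) r) + (\<Sum>n<Suc L. thcoef N i (Suc L) (Suc L + n))"
    by (rule sum_lessThan_add)
  also have "(\<Sum>r<Suc L. thcoef N i (Suc L) r) = (\<Sum>n<Suc L. thcoef N i (Suc L) (Suc L - Suc n))"
    by (rule sum.nat_diff_reindex[symmetric])
  also have "\<dots> = (\<Sum>n<Suc L. - ((- 1) ^ n * fps_X ^ thexp_neg N i (Suc n)))"
    by (rule sum.cong) (auto simp: thcoef_def Suc_diff_le)
  also have "(\<Sum>n<Suc L. thcoef N i (Suc L) (Suc L + n)) = (\<Sum>n<Suc L. (- 1) ^ n * fps_X ^ thexp_pos N i n)"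
    by (rule sum.cong) (auto simp: thcoef_def)
  finally show ?thesis
    by (simp add: sum.distrib[symmetric] algebra_simps)
qed

text \<open>\<open>2 * i < N\<close> keeps the classes 0, i and -i distinct, so three products merge
  into one product over a set. Factors of degree above L are 1 to this order.\<close>

lemma jacobi_triple_product:
  assumes "0 < i" "2 * i < N"
  shows "eq_upto L (\<Sum>n<Suc L. (- 1) ^ n * (fps_X ^ thexp_pos N i n - fps_X ^ thexp_neg N i (Suc n)))
    (\<Prod>m | m \<in> {1..L} \<and> m mod N \<in> {0, i, N - i}. 1 - fps_X ^ m)"
proof -
  have iN: "i < N" using assms by simp
  \<comment> \<open>The least R allowed by \<open>theta_neg\<close> at b = L + 1; it also makes the
    index range in \<open>thcoef_sum\<close> pair up completely.\<close>
  define R where "R = 2 * L + 1"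
  let ?c = "thcoef N i"
  define A1 where "A1 = (\<lambda>m. N * m + i) ` {..<Suc L}"
  define A2 where "A2 = (\<lambda>m. N * Suc m - i) ` {..<L}"
  define A3 where "A3 = (\<lambda>m. N * m) ` {0<..R}"
  have inj: "inj_on (\<lambda>m. N * m + i) {..<Suc L}" "inj_on (\<lambda>m. N * Suc m - i) {..<L}"
    "inj_on (\<lambda>m. N * m) {0<..R}"
  proof -
    show "inj_on (\<lambda>m. N * Suc m - i) {..<L}"
    proof (rule inj_onI)
      fix x y assume "N * Suc x - i = N * Suc y - i"
      moreover have "i \<le> N * Suc x" "i \<le> N * Suc y" using iN by (simp_all add: trans_le_add1)
      ultimately have "N * Suc x = N * Suc y" by linarith
      then show "x = y" using iN by simp
    qed
  qed (use iN in \<open>auto simp: inj_on_def\<close>)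
  have mod: "\<And>m. m \<in> A1 \<Longrightarrow> m mod N = i" "\<And>m. m \<in> A2 \<Longrightarrow> m mod N = N - i"
    "\<And>m. m \<in> A3 \<Longrightarrow> m mod N = 0"
  proof -
    fix m assume "m \<in> A2"
    then obtain x where "m = N * Suc x - i" by (auto simp: A2_def)
    then have "m = N - i + N * x" using iN by simp
    then have "m mod N = (N - i) mod N" by (simp only: mod_mult_self2)
    then show "m mod N = N - i" using assms by simp
  qed (use iN in \<open>auto simp: A1_def A3_def\<close>)
  have fin: "finite A1" "finite A2" "finite A3" by (auto simp: A1_def A2_def A3_def)
  have disj: "A1 \<inter> A2 = {}" "(A1 \<union> A2) \<inter> A3 = {}"
  proof -
    have "i \<noteq> N - i" "i \<noteq> 0" "N - i \<noteq> 0" using assms by auto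
    then show "A1 \<inter> A2 = {}" "(A1 \<union> A2) \<inter> A3 = {}"
      using mod by (metis disjoint_iff, metis UnE disjoint_iff)
  qed
  have "eq_upto L (\<Sum>r\<le>R. ?c (Suc L) r) (\<Sum>r\<le>R. ?c (Suc L) r * ptail N R r)"
    by (rule eq_upto_sym, rule theta_neg_limit[OF iN])
  also have "eq_upto L \<dots> ((\<Prod>m<Suc L. 1 - fps_X ^ (N * m + i)) * (\<Sum>r\<le>R. ?c 0 r * ptail N R r))"
    by (rule theta_neg[OF iN]) (simp_all add: R_def)
  also have "eq_upto L \<dots> ((\<Prod>m<Suc L. 1 - fps_X ^ (N * m + i)) *
      ((\<Prod>m<L. 1 - fps_X ^ (N * Suc m - i)) * ptail N R 0))"
    by (intro eq_upto_mult_left eq_upto_trans[OF theta_pos[OF iN, of L R L] eq_upto_mult_left[OF theta_pos_limit[OF iN]]])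
      (simp add: R_def)
  also have "\<dots> = (\<Prod>m\<in>A1. 1 - fps_X ^ m) * ((\<Prod>m\<in>A2. 1 - fps_X ^ m) * (\<Prod>m\<in>A3. 1 - fps_X ^ m))"
    unfolding A1_def A2_def A3_def ptail_def
    by (simp only: prod.reindex[OF inj(1)] prod.reindex[OF inj(2)] prod.reindex[OF inj(3)] comp_def)
  also have "\<dots> = (\<Prod>m\<in>A1 \<union> A2 \<union> A3. 1 - fps_X ^ m)"
    using fin disj by (simp add: prod.union_disjoint mult.assoc)
  also have "eq_upto L \<dots> (\<Prod>m\<in>(A1 \<union> A2 \<union> A3) \<inter> {..L}. 1 - fps_X ^ m)"
    using fin by (intro eq_upto_prod_restrict) simp
  also have "(A1 \<union> A2 \<union> A3) \<inter> {..L} = {m. m \<in> {1..L} \<and> m mod N \<in> {0, i, N - i}}"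
  proof (intro equalityI subsetI)
    fix m assume m: "m \<in> (A1 \<union> A2 \<union> A3) \<inter> {..L}"
    have "0 < N * Suc x - i" for x using iN by (simp add: trans_less_add1)
    then have "0 < m" using m assms by (auto simp: A1_def A2_def A3_def)
    then show "m \<in> {m. m \<in> {1..L} \<and> m mod N \<in> {0, i, N - i}}" using m mod by auto
  next
    fix m assume m: "m \<in> {m. m \<in> {1..L} \<and> m mod N \<in> {0, i, N - i}}"
    define q where "q = m div N"
    have mq: "m = N * q + m mod N" by (simp add: q_def)
    have "q \<le> m" by (simp add: q_def)
    then have q: "q \<le> L" using m by simp
    consider "m mod N = 0" | "m mod N = i" | "m mod N = N - i" using m by auto
    then have "m \<in> A1 \<union> A2 \<union> A3"
    proof cases
      case 1
      then show ?thesis using mq m q by (auto simp: A3_def R_def image_iff intro!: bexI[of _ q])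
    next
      case 2
      then show ?thesis using mq q by (auto simp: A1_def)
    next
      case 3
      have "q \<le> N * q" using iN by (cases N) auto
      moreover have "N * q + (N - i) \<le> L" using mq 3 m by simp
      ultimately have "q < L" using iN by linarith
      moreover have "m = N * Suc q - i" using mq 3 iN by simp
      ultimately show ?thesis by (auto simp: A2_def)
    qed
    then show "m \<in> (A1 \<union> A2 \<union> A3) \<inter> {..L}" using m by auto
  qed
  finally show ?thesis by (simp only: R_def thcoef_sum)
qed

section \<open>Partitions with a difference condition\<close>

lemma eq_upto_gf_1:
  assumes "[] \<in> S" "\<And>xs x. xs \<in> S \<Longrightarrow> x \<in> set xs \<Longrightarrow> L < x"
  shows "eq_upto L (gf sum_list S) 1"
  unfolding eq_upto_iff
proof (intro allI impI)
  fix n assume n: "n \<le> L"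
  have "xs = []" if "xs \<in> S" "sum_list xs = n" for xs
  proof (cases xs)
    case (Cons x ys)
    then show ?thesis using assms(2)[OF that(1), of x] that n by auto
  qed
  then have "xs \<in> S \<and> sum_list xs = n \<longleftrightarrow> n = 0 \<and> xs = []" for xs
    using assms(1) by (metis sum_list.Nil)
  then have E: "{xs \<in> S. sum_list xs = n} = {xs. n = 0 \<and> xs = []}" by (rule Collect_cong)
  show "fps_nth (gf sum_list S) n = fps_nth 1 n"
    unfolding gf_def fps_nth_Abs_fps E by (cases "n = 0") simp_all
qed

lemma is_partition_append:
  "is_partition (xs @ ys) \<longleftrightarrow> is_partition xs \<and> is_partition ys \<and> (\<forall>x\<in>set xs. \<forall>y\<in>set ys. y \<le> x)"
  by (auto simp: is_partition_def sorted_wrt_append)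

lemma is_partition_single: "is_partition [a] \<longleftrightarrow> 0 < a"
  by (simp add: is_partition_def)

lemma is_partition_replicate: "0 < a \<Longrightarrow> is_partition (replicate n a)"
  by (auto simp: is_partition_def sorted_wrt_iff_nth_less)

lemma finite_fibers_partitions: "S \<subseteq> {xs. is_partition xs} \<Longrightarrow> finite_fibers sum_list S"
  by (rule finite_fibers_lists) (auto simp: is_partition_def)

lemma count_list_replicate_same: "count_list (replicate n a) b = (if a = b then n else 0)"
  by (induction n) auto

text \<open>Parts are non-increasing, so the least permitted value s + 1 can occur only in a final
  block.\<close>

lemma is_partition_split:
  assumes "is_partition xs" "\<forall>x\<in>set xs. s < x"
  shows "filter (\<lambda>x. Suc s < x) xs @ replicate (count_list xs (Suc s)) (Suc s) = xs"
  using assms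
proof (induction xs)
  case (Cons x xs)
  show ?case
  proof (cases "Suc s < x")
    case True
    then show ?thesis using Cons by (simp add: is_partition_def)
  next
    case False
    then have "\<forall>y\<in>set (x # xs). y = Suc s" using Cons.prems by (force simp: is_partition_def)
    then have "x # xs = replicate (length (x # xs)) (Suc s)"
      using replicate_length_same by metis
    then obtain n where n: "x # xs = replicate n (Suc s)" by blast
    then show ?thesis by (simp add: count_list_replicate_same)
  qed
qed simp

section \<open>Euler products for partitions with prescribed part sizes\<close>

definition parts_above :: "nat set \<Rightarrow> nat \<Rightarrow> nat list set" where
  "parts_above T s = {xs. is_partition xs \<and> (\<forall>x\<in>set xs. s < x \<and> x \<in> T)}"

text \<open>A partition either has no part s + 1 or ends in one. Deleting that last part leads back
  to the same set, which yields a geometric series.\<close>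

lemma parts_above_step:
  assumes "Suc s \<in> T"
  shows "(1 - fps_X ^ Suc s) * gf sum_list (parts_above T s) = gf sum_list (parts_above T (Suc s))"
proof -
  let ?h = "\<lambda>xs. xs @ [Suc s]"
  have split: "parts_above T s = parts_above T (Suc s) \<union> ?h ` parts_above T s" (is "?A = ?B \<union> ?C")
  proof (intro equalityI subsetI)
    fix xs assume xs: "xs \<in> ?A"
    show "xs \<in> ?B \<union> ?C"
    proof (cases "Suc s \<in> set xs")
      case True
      then have "0 < count_list xs (Suc s)" by (metis count_list_0_iff gr0I)
      then obtain c where "count_list xs (Suc s) = Suc c" by (metis gr0_implies_Suc)
      with is_partition_split[of xs s] xs
      have "xs = (filter (\<lambda>x. Suc s < x) xs @ replicate c (Suc s)) @ [Suc s]"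
        by (simp add: parts_above_def replicate_append_same)
      then obtain ys where ys: "xs = ys @ [Suc s]" by blast
      then show ?thesis using xs by (auto simp: parts_above_def is_partition_append)
    next
      case False
      then have "Suc s < x" if "x \<in> set xs" for x
        using that xs by (metis (mono_tags, lifting) Suc_lessI mem_Collect_eq parts_above_def)
      then show ?thesis using xs by (simp add: parts_above_def)
    qed
  next
    fix xs assume "xs \<in> ?B \<union> ?C"
    then show "xs \<in> ?A"
    proof
      assume "xs \<in> ?C"
      then obtain ys where "xs = ys @ [Suc s]" "ys \<in> ?A" by blast
      then show ?thesis
        using assms by (auto simp: parts_above_def is_partition_append is_partition_single)
    qed (auto simp: parts_above_def)
  qed
  have "gf sum_list ?A = gf sum_list (?B \<union> ?C)" by (rule arg_cong[OF split])
  also have "\<dots> = gf sum_list ?B + gf sum_list ?C"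
  proof (rule gf_Un)
    show "finite_fibers sum_list ?B" by (rule finite_fibers_partitions) (auto simp: parts_above_def)
    show "finite_fibers sum_list ?C"
    proof (rule finite_fibers_lists)
      fix xs assume "xs \<in> ?C"
      then show "(\<forall>x\<in>set xs. 0 < x) \<and> sum_list xs \<le> sum_list xs"
        by (auto simp: parts_above_def is_partition_def)
    qed
  qed (auto simp: parts_above_def)
  also have "gf sum_list ?C = fps_X ^ Suc s * gf sum_list ?A"
    by (rule gf_shift) (auto simp: inj_on_def)
  finally have "gf sum_list ?A - fps_X ^ Suc s * gf sum_list ?A = gf sum_list ?B"
    by (rule diff_eq_eq[THEN iffD2])
  then show ?thesis by (simp only: left_diff_distrib mult_1)
qed

lemma parts_above_prod:
  "(\<Prod>m | m \<in> {1..s} \<and> m \<in> T. 1 - fps_X ^ m) * gf sum_list (parts_above T 0) = gf sum_list (parts_above T s)"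
proof (induction s)
  case (Suc s)
  show ?case
  proof (cases "Suc s \<in> T")
    case True
    then have "{m. m \<in> {1..Suc s} \<and> m \<in> T} = insert (Suc s) {m. m \<in> {1..s} \<and> m \<in> T}" by auto
    then have "(\<Prod>m | m \<in> {1..Suc s} \<and> m \<in> T. 1 - fps_X ^ m :: int fps) =
       (1 - fps_X ^ Suc s) * (\<Prod>m | m \<in> {1..s} \<and> m \<in> T. 1 - fps_X ^ m)"
      by (simp del: power_Suc)
    then show ?thesis using Suc parts_above_step[OF True]
      by (simp only: mult.assoc)
  next
    case False
    then have "{m. m \<in> {1..Suc s} \<and> m \<in> T} = {m. m \<in> {1..s} \<and> m \<in> T}"
      by (auto simp: le_Suc_eq)
    moreover have "s < x \<and> x \<in> T \<longleftrightarrow> Suc s < x \<and> x \<in> T" for x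
      using False by (metis Suc_lessD Suc_lessI)
    then have "parts_above T (Suc s) = parts_above T s"
      by (simp add: parts_above_def)
    ultimately show ?thesis using Suc by simp
  qed
qed simp

text \<open>Euler's product without inverses: after L steps all parts exceed L, and only the empty
  partition is visible up to degree L.\<close>

lemma eq_upto_parts_above:
  "eq_upto L ((\<Prod>m | m \<in> {1..L} \<and> m \<in> T. 1 - fps_X ^ m) * gf sum_list (parts_above T 0)) 1"
  unfolding parts_above_prod by (rule eq_upto_gf_1) (auto simp: parts_above_def is_partition_def)

section \<open>Recursion for the partitions with a difference condition\<close>

definition admissible :: "nat \<Rightarrow> nat \<Rightarrow> nat \<Rightarrow> nat \<Rightarrow> nat \<Rightarrow> nat \<Rightarrow> bool" where
  "admissible k d e v a b \<longleftrightarrow> a + b < k \<and> (a + b = k - 1 \<longrightarrow> [v * a + Suc v * b = e] (mod d))"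

text \<open>The residue \<open>e\<close> refers to the actual sizes of the parts, so it stays fixed when \<open>s\<close> grows.\<close>

definition diff_parts :: "nat \<Rightarrow> nat \<Rightarrow> nat \<Rightarrow> nat \<Rightarrow> nat \<Rightarrow> nat list set" where
  "diff_parts k d e s i = {xs. is_partition xs \<and> (\<forall>x\<in>set xs. s < x) \<and> count_list xs (Suc s) < i \<and>
     (\<forall>v>s. admissible k d e v (count_list xs v) (count_list xs (Suc v)))}"

lemma diff_parts_0 [simp]: "diff_parts k d e s 0 = {}"
  by (simp add: diff_parts_def)

text \<open>Only the extreme value b = k - 1 - i is subject to the congruence, so for a fixed
  multiplicity i of v the permitted multiplicities of v + 1 form an initial segment. This is why the
  recursion stays inside the family \<open>diff_parts\<close>.\<close>

lemma admissible_iff: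
  assumes "i < k"
  shows "admissible k d e v i b \<longleftrightarrow> b < (if [v * i + Suc v * (k - 1 - i) = e] (mod d) then k - i else k - 1 - i)"
proof -
  have "i + b < k \<longleftrightarrow> b < k - i" "i + b = k - 1 \<longleftrightarrow> b = k - 1 - i"
    using assms by linarith+
  then show ?thesis unfolding admissible_def using assms by auto
qed

text \<open>The part s + 1 occurs fewer than i times or exactly i times. In the second case its
  deletion leaves the conditions at larger v intact, and the condition at s + 1 becomes a bound on
  the multiplicity of s + 2.\<close>

lemma diff_parts_Suc:
  assumes "i < k"
  shows "diff_parts k d e s (Suc i) = diff_parts k d e s i \<union> (\<lambda>xs. xs @ replicate i (Suc s)) `
     diff_parts k d e (Suc s) (if [Suc s * i + Suc (Suc s) * (k - 1 - i) = e] (mod d) then k - i else k - 1 - i)"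
    (is "?A = ?B \<union> ?h ` diff_parts k d e (Suc s) ?i'")
proof (intro equalityI subsetI)
  fix xs assume xs: "xs \<in> ?A"
  show "xs \<in> ?B \<union> ?h ` diff_parts k d e (Suc s) ?i'"
  proof (cases "count_list xs (Suc s) < i")
    case True
    then show ?thesis using xs by (simp add: diff_parts_def)
  next
    case False
    then have c: "count_list xs (Suc s) = i" using xs by (simp add: diff_parts_def)
    define ys where "ys = filter (\<lambda>x. Suc s < x) xs"
    have xs_eq: "xs = ?h ys"
      using is_partition_split[of xs s] xs c by (simp add: diff_parts_def ys_def)
    have ct: "count_list xs v = count_list ys v" if "Suc s < v" for v
      using that by (simp add: xs_eq count_list_replicate_same)
    have D: "admissible k d e v (count_list xs v) (count_list xs (Suc v))" if "s < v" for v
      using xs that by (simp add: diff_parts_def)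
    have "count_list ys (Suc (Suc s)) < ?i'"
      using D[of "Suc s"] unfolding c admissible_iff[OF assms] by (simp add: ct)
    moreover have "is_partition xs" using xs by (simp add: diff_parts_def)
    then have "is_partition ys" by (simp add: xs_eq is_partition_append)
    moreover have "\<forall>x\<in>set ys. Suc s < x" by (simp add: ys_def)
    moreover have "admissible k d e v (count_list ys v) (count_list ys (Suc v))" if "Suc s < v" for v
      using D[of v] ct[of v] ct[of "Suc v"] that by simp
    ultimately have "ys \<in> diff_parts k d e (Suc s) ?i'" by (simp add: diff_parts_def)
    then show ?thesis using xs_eq by blast
  qed
next
  fix xs assume "xs \<in> ?B \<union> ?h ` diff_parts k d e (Suc s) ?i'"
  then show "xs \<in> ?A"
  proof
    assume "xs \<in> ?h ` diff_parts k d e (Suc s) ?i'"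
    then obtain ys where ys: "ys \<in> diff_parts k d e (Suc s) ?i'" and xs: "xs = ?h ys" by blast
    have gt: "\<forall>x\<in>set ys. Suc s < x" and p: "is_partition ys" and c: "count_list ys (Suc (Suc s)) < ?i'"
      using ys by (simp_all add: diff_parts_def)
    have c0: "count_list ys (Suc s) = 0" using gt by (auto simp: count_list_0_iff)
    have ct: "count_list xs v = (if v = Suc s then i else count_list ys v)" for v
      using c0 by (simp add: xs count_list_replicate_same)
    have "admissible k d e v (count_list xs v) (count_list xs (Suc v))" if "s < v" for v
    proof (cases "v = Suc s")
      case True
      have "admissible k d e (Suc s) i (count_list ys (Suc (Suc s)))"
        unfolding admissible_iff[OF assms] by (rule c)
      then show ?thesis unfolding True ct by simp
    next
      case False
      then show ?thesis using ys that by (simp add: ct diff_parts_def)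
    qed
    moreover have "is_partition xs" using p gt
      by (auto simp: xs is_partition_append is_partition_replicate)
    moreover have "\<forall>x\<in>set xs. s < x" using gt by (auto simp: xs)
    moreover have "count_list xs (Suc s) < Suc i" by (simp add: ct)
    ultimately show ?thesis unfolding diff_parts_def by blast
  qed (auto simp: diff_parts_def)
qed

lemma gf_diff_parts_Suc:
  assumes "i < k"
  shows "gf sum_list (diff_parts k d e s (Suc i)) = gf sum_list (diff_parts k d e s i) + fps_X ^ (Suc s * i) *
     gf sum_list (diff_parts k d e (Suc s)
       (if [Suc s * i + Suc (Suc s) * (k - 1 - i) = e] (mod d) then k - i else k - 1 - i))"
    (is "?l = ?r + _ * gf sum_list ?D")
proof -
  let ?h = "\<lambda>xs. xs @ replicate i (Suc s)"
  have "finite_fibers sum_list (diff_parts k d e s (Suc i))"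
    by (rule finite_fibers_partitions) (auto simp: diff_parts_def)
  then have fin: "finite_fibers sum_list (diff_parts k d e s i)" "finite_fibers sum_list (?h ` ?D)"
    unfolding diff_parts_Suc[OF assms] by (rule finite_fibers_subset; blast)+
  have "count_list (?h ys) (Suc s) = i" if "ys \<in> ?D" for ys
  proof -
    have "Suc s \<notin> set ys" using that by (auto simp: diff_parts_def)
    then show ?thesis by (simp add: count_list_replicate_same count_list_0_iff)
  qed
  then have "diff_parts k d e s i \<inter> ?h ` ?D = {}" by (auto simp: diff_parts_def)
  from gf_Un[OF fin this]
  have "?l = ?r + gf sum_list (?h ` ?D)" unfolding diff_parts_Suc[OF assms] .
  also have "gf sum_list (?h ` ?D) = fps_X ^ (Suc s * i) * gf sum_list ?D"
    by (rule gf_shift) (auto simp: inj_on_def sum_list_replicate)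
  finally show ?thesis .
qed

text \<open>The hypotheses put the empty partition into the set. For k = 1 the extreme value a + b =
  k - 1 is attained by a = b = 0, so the congruence has to be vacuous there.\<close>

lemma eq_upto_diff_parts:
  assumes "0 < i" "2 \<le> k \<or> k = 1 \<and> d = 1"
  shows "eq_upto L (gf sum_list (diff_parts k d e L i)) 1"
  using assms by (intro eq_upto_gf_1) (auto simp: diff_parts_def admissible_def is_partition_def)

section \<open>The series solution of the recursion\<close>

text \<open>For i <= k and N = 2k + j this is s(k+j-1)n + N n(n+1)/2 - i n, arranged so that nothing
  is halved or negative.\<close>

definition series_exp :: "nat \<Rightarrow> nat \<Rightarrow> nat \<Rightarrow> nat \<Rightarrow> nat \<Rightarrow> nat" where
  "series_exp k j s i n = s * (k + j - 1) * n + k * n * n + (k - i) * n + j * \<Sum>{..n}"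

definition qblock :: "nat \<Rightarrow> nat \<Rightarrow> nat \<Rightarrow> int fps" where
  "qblock d s n = (\<Prod>m\<in>{n<..n + s}. 1 - fps_X ^ (d * m))"

definition series_term :: "nat \<Rightarrow> nat \<Rightarrow> nat \<Rightarrow> nat \<Rightarrow> nat \<Rightarrow> int fps" where
  "series_term k j s i n = (- 1) ^ n * fps_X ^ series_exp k j s i n * (1 - fps_X ^ (i * (s + 2 * n + 1))) * qblock (2 - j) s n"

lemma qblock_Suc_right: "qblock d (Suc s) n = qblock d s n * (1 - fps_X ^ (d * (n + s + 1)))"
proof -
  have "{n<..n + Suc s} = insert (n + s + 1) {n<..n + s}" by auto
  then show ?thesis by (simp add: qblock_def mult.commute del: mult_Suc_right)
qed

lemma qblock_Suc_left: "qblock d (Suc s) n = (1 - fps_X ^ (d * Suc n)) * qblock d s (Suc n)"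
proof -
  have "{n<..n + Suc s} = insert (Suc n) {Suc n<..Suc n + s}" by auto
  then show ?thesis by (simp add: qblock_def del: mult_Suc_right)
qed

text \<open>A telescoping certificate \<open>al\<close> for the recursion: \<open>al 0\<close>
  vanishes through 1 - q^(d n), and later \<open>al\<close> values have high degree. Once all
  exponents are written through the monomials p, y, w, z, v, the claim is a polynomial
  identity.\<close>

lemma series_term_rec:
  fixes k j s i n :: nat
  defines "d \<equiv> 2 - j"
  defines "al \<equiv> \<lambda>n. (- 1) ^ n * fps_X ^ series_exp k j s i n * (1 - fps_X ^ (d * n)) * qblock d s n"
  assumes "j \<le> 1" "d \<le> i" "i \<le> k"
  shows "series_term k j s i n - series_term k j s (i - d) n -
     fps_X ^ (Suc s * (i - d)) * series_term k j (Suc s) (k + 1 - i) n = al n - al (Suc n)"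
proof -
  obtain e where i: "i = d + e" using assms(4) by (metis le_Suc_ex)
  obtain q where k: "k = i + q" using assms(5) by (metis le_Suc_ex)
  have j: "j = 0 \<and> d = 2 \<or> j = 1 \<and> d = 1" using assms(3) by (auto simp: d_def)
  have e1: "series_exp k j s e n = series_exp k j s i n + d * n"
    by (simp add: series_exp_def k i algebra_simps)
  have e2: "Suc s * e + series_exp k j (Suc s) (k + 1 - i) n = series_exp k j s i n + d * n + e * (s + 2 * n + 1)"
    using j by (auto simp: series_exp_def k i algebra_simps)
  have e3: "series_exp k j s i n + d * n + e * (s + 2 * n + 1) + (k + 1 - i) * (Suc s + 2 * n + 1) = series_exp k j s i (Suc n)"
    using j by (auto simp: series_exp_def k i algebra_simps)
  have e4: "i * (s + 2 * n + 1) = e * (s + 2 * n + 1) + d * n + d * (n + s + 1)"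
    by (simp add: i algebra_simps)
  define p :: "int fps" where "p = fps_X ^ series_exp k j s i n"
  define y :: "int fps" where "y = fps_X ^ (d * n)"
  define w :: "int fps" where "w = fps_X ^ (e * (s + 2 * n + 1))"
  define z :: "int fps" where "z = fps_X ^ (d * (n + s + 1))"
  define v :: "int fps" where "v = fps_X ^ ((k + 1 - i) * (Suc s + 2 * n + 1))"
  define p' :: "int fps" where "p' = fps_X ^ series_exp k j s i (Suc n)"
  define b where "b = qblock d s n"
  define b' where "b' = (1 - fps_X ^ (d * Suc n)) * qblock d s (Suc n)"
  define sg :: "int fps" where "sg = (- 1) ^ n"
  \<comment> \<open>The block of length s + 1 is factored once at its lower and once at its upper
    end.\<close>
  have b': "b' = b * (1 - z)"
    unfolding b'_def b_def z_def qblock_Suc_right[symmetric] qblock_Suc_left[symmetric] ..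
  have p': "p' = p * y * w * v"
    unfolding p'_def p_def y_def w_def v_def e3[symmetric] power_add ..
  have t1: "series_term k j s i n = sg * p * (1 - w * y * z) * b"
    unfolding series_term_def sg_def p_def w_def y_def z_def b_def e4 power_add d_def ..
  have t2: "series_term k j s (i - d) n = sg * (p * y) * (1 - w) * b"
    unfolding i add_diff_cancel_left' unfolding i[symmetric] series_term_def e1
    unfolding sg_def p_def w_def y_def b_def power_add d_def ..
  have "fps_X ^ (Suc s * (i - d)) * series_term k j (Suc s) (k + 1 - i) n =
      fps_X ^ (Suc s * e + series_exp k j (Suc s) (k + 1 - i) n) * (sg * (1 - v) * qblock d (Suc s) n)"
    unfolding series_term_def sg_def v_def power_add d_def[symmetric] by (simp add: i mult_ac)
  also have "\<dots> = (p * y * w) * (sg * (1 - v) * (b * (1 - z)))"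
    unfolding e2 power_add p_def y_def w_def qblock_Suc_right b_def z_def ..
  finally have t3: "fps_X ^ (Suc s * (i - d)) * series_term k j (Suc s) (k + 1 - i) n =
      (p * y * w) * (sg * (1 - v) * (b * (1 - z)))" .
  have a1: "al n = sg * p * (1 - y) * b"
    unfolding al_def sg_def p_def y_def b_def ..
  have a2: "al (Suc n) = - (sg * p' * b')"
    unfolding al_def sg_def p'_def b'_def by (simp add: mult_ac)
  show ?thesis unfolding t1 t2 t3 a1 a2 b' p' by (simp add: algebra_simps)
qed

text \<open>This is the step-2 recursion at i = 1. Formally the series at index -1 equals
  -q^(-(s+1)) times the series at index 1; multiplying through by q^(s+1) clears the negative powers
  and explains the extra \<open>Suc s\<close> in the certificate.\<close>

lemma series_term_rec_1:
  fixes k s n :: nat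
  defines "al \<equiv> \<lambda>n. (- 1) ^ n * fps_X ^ (series_exp k 0 s 1 n + Suc s) * (1 - fps_X ^ (2 * n)) * qblock 2 s n"
  assumes "1 \<le> k"
  shows "(1 + fps_X ^ Suc s) * series_term k 0 s 1 n - series_term k 0 (Suc s) k n = al n - al (Suc n)"
proof -
  obtain q where k: "k = Suc q" using assms(2) by (metis Suc_le_D One_nat_def)
  have e1: "series_exp k 0 (Suc s) k n = series_exp k 0 s 1 n"
    by (simp add: series_exp_def k algebra_simps)
  have e2: "series_exp k 0 s 1 n + k * (Suc s + 2 * n + 1) = series_exp k 0 s 1 (Suc n) + Suc s"
    by (simp add: series_exp_def k algebra_simps)
  have e3: "1 * (s + 2 * n + 1) = Suc s + 2 * n" "2 * (n + s + 1) = Suc s + Suc s + 2 * n" by simp_all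
  define p :: "int fps" where "p = fps_X ^ series_exp k 0 s 1 n"
  define g :: "int fps" where "g = fps_X ^ Suc s"
  define h :: "int fps" where "h = fps_X ^ (2 * n)"
  define v :: "int fps" where "v = fps_X ^ (k * (Suc s + 2 * n + 1))"
  define p' :: "int fps" where "p' = fps_X ^ (series_exp k 0 s 1 (Suc n) + Suc s)"
  define b where "b = qblock 2 s n"
  define b' where "b' = (1 - fps_X ^ (2 * Suc n)) * qblock 2 s (Suc n)"
  define sg :: "int fps" where "sg = (- 1) ^ n"
  have b': "b' = b * (1 - g * g * h)"
    unfolding b'_def b_def g_def h_def power_add[symmetric] e3(2)[symmetric]
      qblock_Suc_right[symmetric] qblock_Suc_left[symmetric] ..
  have p': "p' = p * v"
    unfolding p'_def p_def v_def e2[symmetric] power_add ..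
  have t1: "series_term k 0 s 1 n = sg * p * (1 - g * h) * b"
    unfolding series_term_def sg_def p_def g_def h_def b_def e3 power_add minus_nat.diff_0 ..
  have t2: "series_term k 0 (Suc s) k n = sg * p * (1 - v) * (b * (1 - g * g * h))"
    unfolding series_term_def sg_def p_def v_def e1 b'[symmetric] b'_def qblock_Suc_left minus_nat.diff_0 ..
  have a1: "al n = sg * (p * g) * (1 - h) * b"
    unfolding al_def sg_def p_def g_def h_def b_def power_add ..
  have a2: "al (Suc n) = - (sg * p' * b')"
    unfolding al_def sg_def p'_def b'_def by (simp add: mult_ac)
  show ?thesis unfolding t1 t2 a1 a2 b' p' g_def[symmetric] by (simp add: algebra_simps)
qed

definition series_sum :: "nat \<Rightarrow> nat \<Rightarrow> nat \<Rightarrow> nat \<Rightarrow> nat \<Rightarrow> int fps" where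
  "series_sum L k j s i = (\<Sum>n<Suc L. series_term k j s i n)"

lemma series_exp_ge: "1 \<le> k \<Longrightarrow> n \<le> series_exp k j s i n"
proof -
  assume "1 \<le> k"
  then have "n \<le> k * n * n" by (cases "n = 0") simp_all
  then show ?thesis unfolding series_exp_def by linarith
qed

lemma series_sum_rec:
  assumes "j \<le> 1" "2 - j \<le> i" "i \<le> k" "1 \<le> k"
  shows "eq_upto L (series_sum L k j s (i - (2 - j)) + fps_X ^ (Suc s * (i - (2 - j))) * series_sum L k j (Suc s) (k + 1 - i))
     (series_sum L k j s i)"
proof -
  define al where "al = (\<lambda>n. (- 1) ^ n * fps_X ^ series_exp k j s i n * (1 - fps_X ^ ((2 - j) * n)) * qblock (2 - j) s n)"
  have "series_sum L k j s i - series_sum L k j s (i - (2 - j)) - fps_X ^ (Suc s * (i - (2 - j))) * series_sum L k j (Suc s) (k + 1 - i)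
      = (\<Sum>n<Suc L. al n - al (Suc n))"
    unfolding series_sum_def sum_distrib_left sum_subtractf[symmetric] al_def
    by (rule sum.cong) (use series_term_rec[OF assms(1-3)] in simp_all)
  also have "\<dots> = al 0 - al (Suc L)" by (rule sum_lessThan_telescope')
  also have "al 0 = 0" by (simp add: al_def)
  finally have *: "series_sum L k j s (i - (2 - j)) + fps_X ^ (Suc s * (i - (2 - j))) * series_sum L k j (Suc s) (k + 1 - i)
      = series_sum L k j s i + al (Suc L)"
    by (simp add: algebra_simps)
  have "L < series_exp k j s i (Suc L)" using series_exp_ge[OF assms(4), of "Suc L"] by (rule less_le_trans[rotated]) simp
  from eq_upto_X_power_0[OF this, of "(- 1) ^ Suc L * (1 - fps_X ^ ((2 - j) * Suc L)) * qblock (2 - j) s (Suc L)"]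
  have "eq_upto L (al (Suc L)) 0" by (simp only: al_def mult_ac)
  from eq_upto_add[OF eq_upto_refl this] show ?thesis unfolding * by simp
qed

lemma series_sum_rec_1:
  assumes "1 \<le> k"
  shows "eq_upto L (series_sum L k 0 (Suc s) k) ((1 + fps_X ^ Suc s) * series_sum L k 0 s 1)"
proof -
  define al where "al = (\<lambda>n. (- 1) ^ n * fps_X ^ (series_exp k 0 s 1 n + Suc s) * (1 - fps_X ^ (2 * n)) * qblock 2 s n)"
  have "(1 + fps_X ^ Suc s) * series_sum L k 0 s 1 - series_sum L k 0 (Suc s) k = (\<Sum>n<Suc L. al n - al (Suc n))"
    unfolding series_sum_def sum_distrib_left sum_subtractf[symmetric] al_def
    by (rule sum.cong) (use series_term_rec_1[OF assms] in simp_all)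
  also have "\<dots> = al 0 - al (Suc L)" by (rule sum_lessThan_telescope')
  also have "al 0 = 0" by (simp add: al_def)
  finally have *: "series_sum L k 0 (Suc s) k = (1 + fps_X ^ Suc s) * series_sum L k 0 s 1 + al (Suc L)"
    by (simp add: algebra_simps)
  have "Suc L \<le> series_exp k 0 s 1 (Suc L)" using series_exp_ge[OF assms] .
  then have "L < series_exp k 0 s 1 (Suc L) + Suc s" by linarith
  from eq_upto_X_power_0[OF this, of "(- 1) ^ Suc L * (1 - fps_X ^ (2 * Suc L)) * qblock 2 s (Suc L)"]
  have "eq_upto L (al (Suc L)) 0" by (simp only: al_def mult_ac)
  from eq_upto_add[OF eq_upto_refl this] show ?thesis unfolding * by simp
qed

lemma series_sum_0 [simp]: "series_sum L k j s 0 = 0"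
  by (simp add: series_sum_def series_term_def)

text \<open>At s = L the exponent is at least L + 1 for every n > 0, and in the term n = 0 the
  factor 1 - q^(i(L+1)) is invisible.\<close>

lemma series_sum_base:
  assumes "1 \<le> k + j - 1" "1 \<le> k" "0 < i"
  shows "eq_upto L (series_sum L k j L i) (qblock (2 - j) L 0)"
proof -
  have "eq_upto L (series_term k j L i n) 0" if "0 < n" for n
  proof -
    have "L * 1 * 1 \<le> L * (k + j - 1) * n" using assms that by (intro mult_le_mono) auto
    moreover have "1 * 1 * 1 \<le> k * n * n" using assms that by (intro mult_le_mono) auto
    ultimately have "L < series_exp k j L i n" unfolding series_exp_def by linarith
    from eq_upto_X_power_0[OF this, of "(- 1) ^ n * (1 - fps_X ^ (i * (L + 2 * n + 1))) * qblock (2 - j) L n"]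
    show ?thesis by (simp only: series_term_def mult_ac)
  qed
  then have "eq_upto L (\<Sum>n<L. series_term k j L i (Suc n)) (\<Sum>n<L. 0)" by (intro eq_upto_sum) simp
  moreover have "eq_upto L (series_term k j L i 0) (qblock (2 - j) L 0)"
  proof -
    have "L < i * (L + 1)" using assms(3) by (cases i) auto
    from eq_upto_mult[OF eq_upto_1_minus_X[OF this] eq_upto_refl[of L "qblock (2 - j) L 0"]]
    show ?thesis by (simp add: series_term_def series_exp_def)
  qed
  ultimately have "eq_upto L (series_term k j L i 0 + (\<Sum>n<L. series_term k j L i (Suc n))) (qblock (2 - j) L 0 + (\<Sum>n<L. 0))"
    by (intro eq_upto_add)
  then show ?thesis by (simp only: series_sum_def sum.lessThan_Suc_shift sum.neutral_const add_0_right)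
qed

section \<open>The recursion determines the generating function\<close>

lemma cong_mod_2_iff: "[a = b] (mod (2::nat)) \<longleftrightarrow> (even a \<longleftrightarrow> even b)"
  unfolding cong_def by presburger

definition wprod :: "nat \<Rightarrow> nat \<Rightarrow> int fps" where
  "wprod j s = (\<Prod>m\<in>{0<..s}. if j = 0 then 1 + fps_X ^ m else 1)"

lemma wprod_Suc: "wprod j (Suc s) = wprod j s * (if j = 0 then 1 + fps_X ^ Suc s else 1)"
proof -
  have "{0<..Suc s} = insert (Suc s) {0<..s}" by auto
  then show ?thesis by (simp add: wprod_def mult.commute)
qed

text \<open>For j = 0 this is (1 + q^m)(1 - q^m) = 1 - q^(2m); it makes the two solutions of the
  recursion agree at the starting point s = L.\<close>

lemma wprod_mult_qblock: "j \<le> 1 \<Longrightarrow> wprod j L * qblock 1 L 0 = qblock (2 - j) L 0"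
  unfolding wprod_def qblock_def prod.distrib[symmetric] add_0
proof (rule prod.cong)
  fix m assume "j \<le> 1"
  then consider "j = 0" | "j = 1" by linarith
  then show "(if j = 0 then 1 + fps_X ^ m else 1) * (1 - fps_X ^ (1 * m)) = (1 - fps_X ^ ((2 - j) * m) :: int fps)"
    by cases (simp_all add: algebra_simps mult_2_right power_add)
qed simp

text \<open>Downward induction from s = L, with an inner induction on i. The congruence selects a
  class of pairs closed under the passages from (s,i) to (s,i-d) and to (s+1,k+1-i).\<close>

lemma eq_upto_diff_parts_series_sum:
  assumes "j \<le> 1" "2 \<le> k \<or> k = 1 \<and> j = 1" "s \<le> L" "i \<le> k" "[i + s * (k - 1) = Suc e] (mod (2 - j))"
  shows "eq_upto L (wprod j s * qblock 1 L 0 * gf sum_list (diff_parts k (2 - j) e s i)) (series_sum L k j s i)"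
  using assms(3-5)
proof (induction s arbitrary: i rule: inc_induct)
  case base
  show ?case
  proof (cases "i = 0")
    case False
    then have "eq_upto L (wprod j L * qblock 1 L 0 * gf sum_list (diff_parts k (2 - j) e L i)) (wprod j L * qblock 1 L 0 * 1)"
      using assms(2) by (intro eq_upto_mult_left eq_upto_diff_parts) auto
    also have "\<dots> = qblock (2 - j) L 0" by (simp only: wprod_mult_qblock[OF assms(1)] mult_1_right)
    also have "eq_upto L \<dots> (series_sum L k j L i)"
      using assms(2) False by (intro eq_upto_sym[OF series_sum_base]) auto
    finally show ?thesis .
  qed simp
next
  case (step s)
  let ?D = "\<lambda>s i. gf sum_list (diff_parts k (2 - j) e s i)"
  let ?P = "\<lambda>s. wprod j s * qblock 1 L 0"
  have k1: "1 \<le> k" using assms(2) by auto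
  consider "j = 0" "2 \<le> k" | "j = 1" using assms(1,2) by fastforce
  then show ?case
  proof cases
    case 2
    have "eq_upto L (?P s * ?D s i) (series_sum L k j s i)" if "i \<le> k" for i
      using that
    proof (induction i)
      case (Suc i)
      have "?D s (Suc i) = ?D s i + fps_X ^ (Suc s * i) * ?D (Suc s) (k - i)"
        using gf_diff_parts_Suc[of i k "2 - j" e s] Suc.prems 2 by simp
      then have "?P s * ?D s (Suc i) = ?P s * ?D s i + fps_X ^ (Suc s * i) * (?P (Suc s) * ?D (Suc s) (k - i))"
        using 2 by (simp only: wprod_Suc) (simp add: algebra_simps)
      also have "eq_upto L \<dots> (series_sum L k j s i + fps_X ^ (Suc s * i) * series_sum L k j (Suc s) (k - i))"
        using Suc 2 by (intro eq_upto_add eq_upto_mult_left step.IH) simp_all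
      also have "eq_upto L \<dots> (series_sum L k j s (Suc i))"
        using series_sum_rec[of j "Suc i" k L s] 2 Suc.prems k1 by simp
      finally show ?case .
    qed simp
    then show ?thesis using step.prems by simp
  next
    case 1
    have "eq_upto L (?P s * ?D s i) (series_sum L k j s i)" if "i \<le> k" "even (i + s * (k - 1)) = odd e" for i
      using that
    proof (induction i rule: less_induct)
      case (less i)
      consider "i = 0" | "i = 1" | i' where "i = Suc (Suc i')"
        by (metis One_nat_def not0_implies_Suc)
      then show ?case
      proof cases
        case [simp]: 2
        obtain k' where k': "k = Suc k'" using k1 by (metis Suc_le_D One_nat_def)
        \<comment> \<open>No part equals s + 1, and by the parity hypothesis s + 2 may occur up to k
          - 1 times. So the new bound is k, and no second multiplicity is available to pair
          with.\<close>
        have "[Suc s * 0 + Suc (Suc s) * (k - 1 - 0) = e] (mod 2)"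
          using less.prems by (auto simp: cong_mod_2_iff k')
        then have D: "?D s i = ?D (Suc s) k"
          using gf_diff_parts_Suc[of 0 k "2 - j" e s] k1 1 by simp
        have "eq_upto L (?P (Suc s) * ?D (Suc s) k) (series_sum L k j (Suc s) k)"
          using less.prems 1 by (intro step.IH) (auto simp: cong_mod_2_iff k')
        also have "eq_upto L \<dots> ((1 + fps_X ^ Suc s) * series_sum L k j s i)"
          using series_sum_rec_1[OF k1, of L s] 1 by simp
        also have "?P (Suc s) * ?D (Suc s) k = (1 + fps_X ^ Suc s) * (?P s * ?D s i)"
          unfolding D wprod_Suc by (simp only: \<open>j = 0\<close> if_True simp_thms mult_ac)
        finally show ?thesis by (rule eq_upto_cancel[rotated]) (simp del: power_Suc)
      next
        case 3
        obtain q where k: "k = Suc (Suc (i' + q))" using less.prems 3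
          by (metis add_Suc le_Suc_ex)
        \<comment> \<open>Exactly one of the multiplicities i' and i' + 1 satisfies the congruence,
          the larger one, so both give the same bound k - 1 - i'.\<close>
        have a1: "[Suc s * Suc i' + Suc (Suc s) * (k - 1 - Suc i') = e] (mod 2)"
          and a2: "\<not> [Suc s * i' + Suc (Suc s) * (k - 1 - i') = e] (mod 2)"
          using less.prems by (auto simp: cong_mod_2_iff k 3)
        have "?D s i = ?D s i' + fps_X ^ (Suc s * i') * ?D (Suc s) (k - 1 - i')
            + fps_X ^ (Suc s * Suc i') * ?D (Suc s) (k - 1 - i')"
          using gf_diff_parts_Suc[of i' k 2 e s] gf_diff_parts_Suc[of "Suc i'" k 2 e s] a1 a2 1
          by (simp add: 3 k)
        then have "?P s * ?D s i = ?P s * ?D s i' +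
            fps_X ^ (Suc s * i') * (?P (Suc s) * ?D (Suc s) (k - 1 - i'))"
          using 1 by (simp only: wprod_Suc mult_Suc_right power_add) (simp add: algebra_simps)
        also have "eq_upto L \<dots> (series_sum L k j s i' + fps_X ^ (Suc s * i') * series_sum L k j (Suc s) (k - 1 - i'))"
          using less 1 by (intro eq_upto_add eq_upto_mult_left step.IH less.IH) (auto simp: cong_mod_2_iff 3 k)
        also have "eq_upto L \<dots> (series_sum L k j s i)"
          using series_sum_rec[of j i k L s] 1 3 less.prems k1 by (simp add: k)
        finally show ?thesis .
      qed simp
    qed
    then show ?thesis using step.prems 1 by (auto simp: cong_mod_2_iff)
  qed
qed

text \<open>At s = 0 the block is empty, and 1 - q^(i(2n+1)) combines the theta terms of indices n
  and -(n+1).\<close>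

lemma series_sum_theta:
  assumes "j \<le> 1" "1 \<le> i" "i \<le> k"
  shows "series_sum L k j 0 i = (\<Sum>n<Suc L. (- 1) ^ n * (fps_X ^ thexp_pos (2 * k + j) i n
     - fps_X ^ thexp_neg (2 * k + j) i (Suc n)))"
  unfolding series_sum_def
proof (rule sum.cong)
  fix n
  let ?N = "2 * k + j"
  obtain q where k: "k = i + q" using assms(3) by (metis le_Suc_ex)
  have p: "thexp_pos ?N i n = series_exp k j 0 i n"
  proof (induction n)
    case (Suc n)
    have "?N * Suc n - i + series_exp k j 0 i n = series_exp k j 0 i (Suc n)"
      by (simp add: series_exp_def k algebra_simps)
    then show ?case using Suc by (simp add: thexp_pos_def)
  qed (simp add: thexp_pos_def series_exp_def)
  have "thexp_neg ?N i (Suc n) = thexp_pos ?N i n + i * (2 * n + 1)"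
  proof (induction n)
    case (Suc n)
    have "i \<le> ?N * Suc n" using k by simp
    moreover have "thexp_neg ?N i (Suc (Suc n)) = thexp_neg ?N i (Suc n) + (?N * Suc n + i)"
      and "thexp_pos ?N i (Suc n) = thexp_pos ?N i n + (?N * Suc n - i)"
      by (simp_all add: thexp_neg_def thexp_pos_def)
    moreover have "i * (2 * Suc n + 1) = i * (2 * n + 1) + 2 * i" by simp
    ultimately show ?case using Suc by linarith
  qed (simp add: thexp_pos_def thexp_neg_def)
  then show "series_term k j 0 i n = (- 1) ^ n * (fps_X ^ thexp_pos ?N i n - fps_X ^ thexp_neg ?N i (Suc n))"
    by (simp add: series_term_def p qblock_def right_diff_distrib power_add)
qed simp

lemma qblock_eq: "qblock 1 L 0 = (\<Prod>m\<in>{1..L}. 1 - fps_X ^ m)"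
  unfolding qblock_def by (rule prod.cong) auto

text \<open>The coefficient of degree L is compared to precision L, after multiplication by the unit
  with factors 1 - q^m for m <= L.\<close>

lemma gf_diff_parts_eq_parts_above:
  assumes "j \<le> 1" "1 \<le> i" "i \<le> k + j - 1"
  shows "gf sum_list (diff_parts k (2 - j) (i - 1) 0 i) =
    gf sum_list (parts_above {m. m mod (2 * k + j) \<notin> {0, i, 2 * k + j - i}} 0)"
proof (rule fps_ext)
  fix L
  let ?N = "2 * k + j"
  let ?T = "{m. m mod ?N \<notin> {0, i, ?N - i}}"
  let ?A = "gf sum_list (parts_above ?T 0)" and ?D = "gf sum_list (diff_parts k (2 - j) (i - 1) 0 i)"
  let ?B = "\<Prod>m | m \<in> {1..L} \<and> m mod ?N \<in> {0, i, ?N - i}. 1 - fps_X ^ m :: int fps"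
  let ?G = "\<Prod>m | m \<in> {1..L} \<and> m \<in> ?T. 1 - fps_X ^ m :: int fps"
  have ik: "i \<le> k" "2 * i < ?N" "2 \<le> k \<or> k = 1 \<and> j = 1" using assms by linarith+
  have "[i + 0 * (k - 1) = Suc (i - 1)] (mod (2 - j))" using assms(2) by simp
  then have "eq_upto L (wprod j 0 * qblock 1 L 0 * ?D) (series_sum L k j 0 i)"
    using assms ik by (intro eq_upto_diff_parts_series_sum) auto
  then have "eq_upto L (qblock 1 L 0 * ?D) (series_sum L k j 0 i)" by (simp add: wprod_def)
  also have "eq_upto L \<dots> ?B" using assms ik
    by (simp only: series_sum_theta) (rule jacobi_triple_product; simp)
  \<comment> \<open>The factor 1 is replaced by \<open>?G * ?A\<close>, which completes the product
    to all m <= L.\<close>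
  also have "?B = ?B * 1" by simp
  also have "eq_upto L \<dots> (?B * (?G * ?A))"
    by (rule eq_upto_mult_left, rule eq_upto_sym, rule eq_upto_parts_above)
  also have "?B * (?G * ?A) = qblock 1 L 0 * ?A"
  proof -
    have "{1..L} = {m. m \<in> {1..L} \<and> m mod ?N \<in> {0, i, ?N - i}} \<union> {m. m \<in> {1..L} \<and> m \<in> ?T}"
      by blast
    moreover have "(\<Prod>m\<in>\<dots>. 1 - fps_X ^ m) = ?B * ?G"
      by (rule prod.union_disjoint) auto
    ultimately show ?thesis by (simp only: qblock_eq mult.assoc)
  qed
  finally have "eq_upto L (qblock 1 L 0 * ?D) (qblock 1 L 0 * ?A)" by simp
  moreover have "fps_nth (qblock 1 L 0) 0 = 1"
  proof -
    have "eq_upto 0 (qblock 1 L 0) 1" unfolding qblock_def by (rule eq_upto_prod_1) auto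
    then show ?thesis by (simp add: eq_upto_iff)
  qed
  ultimately show "fps_nth ?D L = fps_nth ?A L"
    using eq_upto_cancel eq_upto_iff by blast
qed

section \<open>Difference conditions in terms of multiplicities\<close>

text \<open>These numbers are the parts of the conjugate partition. They locate values: parts equal
  to v occupy the positions above \<open>num_ge xs (Suc v)\<close> and up to
  \<open>num_ge xs v\<close>.\<close>

definition num_ge :: "nat list \<Rightarrow> nat \<Rightarrow> nat" where
  "num_ge xs u = length (filter (\<lambda>x. u \<le> x) xs)"

lemma num_ge_Suc: "num_ge xs u = num_ge xs (Suc u) + count_list xs u"
  by (induction xs) (auto simp: num_ge_def)

lemma num_ge_le: "num_ge xs u \<le> length xs"
  by (simp add: num_ge_def)

lemma less_num_ge_iff:
  "is_partition xs \<Longrightarrow> p < length xs \<Longrightarrow> p < num_ge xs u \<longleftrightarrow> u \<le> xs ! p"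
proof (induction xs arbitrary: p)
  case (Cons x xs)
  have p: "is_partition xs" using Cons.prems by (simp add: is_partition_def)
  show ?case
  proof (cases "u \<le> x")
    case True
    then show ?thesis using Cons.IH[OF p] Cons.prems by (cases p) (simp_all add: num_ge_def)
  next
    case False
    have "\<forall>y\<in>set (x # xs). y \<le> x" using Cons.prems by (auto simp: is_partition_def)
    then have "\<forall>y\<in>set (x # xs). \<not> u \<le> y" using False by auto
    then show ?thesis using Cons.prems nth_mem[of p "x # xs"]
      by (simp only: num_ge_def) (simp add: filter_empty_conv)
  qed
qed simp

lemma sum_part_level:
  assumes "is_partition xs"
  shows "(\<Sum>s\<in>{num_ge xs (Suc v)<..num_ge xs v}. part xs s) = v * count_list xs v"
proof -
  have "part xs s = v" if s: "s \<in> {num_ge xs (Suc v)<..num_ge xs v}" for s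
  proof -
    have l: "s - 1 < length xs" using s num_ge_le[of xs v] by auto
    have "v \<le> xs ! (s - 1)" "\<not> Suc v \<le> xs ! (s - 1)"
      using less_num_ge_iff[OF assms l, of v] less_num_ge_iff[OF assms l, of "Suc v"] s by auto
    then show ?thesis by (simp add: part_def)
  qed
  then have "(\<Sum>s\<in>{num_ge xs (Suc v)<..num_ge xs v}. part xs s) = (\<Sum>s\<in>{num_ge xs (Suc v)<..num_ge xs v}. v)"
    by (rule sum.cong[OF refl])
  then show ?thesis by (simp add: num_ge_Suc[of xs v] mult.commute)
qed

lemma sum_part_levels:
  assumes "is_partition xs"
  shows "(\<Sum>s\<in>{num_ge xs (Suc (Suc v))<..num_ge xs v}. part xs s) =
    v * count_list xs v + Suc v * count_list xs (Suc v)"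
proof -
  have "{num_ge xs (Suc (Suc v))<..num_ge xs v} =
      {num_ge xs (Suc (Suc v))<..num_ge xs (Suc v)} \<union> {num_ge xs (Suc v)<..num_ge xs v}"
    using num_ge_Suc[of xs v] num_ge_Suc[of xs "Suc v"] by auto
  moreover have "(\<Sum>s\<in>\<dots>. part xs s) = (\<Sum>s\<in>{num_ge xs (Suc (Suc v))<..num_ge xs (Suc v)}. part xs s) +
      (\<Sum>s\<in>{num_ge xs (Suc v)<..num_ge xs v}. part xs s)"
    by (rule sum.union_disjoint) auto
  ultimately show ?thesis by (simp only: sum_part_level[OF assms] add.commute)
qed

lemma part_indices_iff: "t \<in> part_indices xs \<longleftrightarrow> 0 < t \<and> t \<le> length xs"
  by (auto simp: part_indices_def)

lemma le_num_ge_iff: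
  assumes "is_partition xs" "t \<in> part_indices xs"
  shows "t \<le> num_ge xs u \<longleftrightarrow> u \<le> part xs t"
proof -
  obtain p where p: "t = Suc p" "p < length xs"
    using assms(2) by (cases t) (auto simp: part_indices_iff)
  then show ?thesis using less_num_ge_iff[OF assms(1) p(2), of u] by (simp add: part_def Suc_le_eq)
qed

text \<open>The parts of size v or v + 1 occupy consecutive positions. There are at least k of them
  exactly when two positions at distance k - 1 both fall into this run.\<close>

lemma difference_condition_iff:
  assumes "is_partition xs" "1 \<le> k"
  shows "(\<forall>t. t \<in> part_indices xs \<and> t + k - 1 \<in> part_indices xs \<longrightarrow> part xs t - part xs (t + k - 1) \<ge> 2) \<longleftrightarrow>
    (\<forall>v>0. count_list xs v + count_list xs (Suc v) < k)"
proof (intro iffI allI impI)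
  fix v :: nat
  assume H: "\<forall>t. t \<in> part_indices xs \<and> t + k - 1 \<in> part_indices xs \<longrightarrow> part xs t - part xs (t + k - 1) \<ge> 2"
  show "count_list xs v + count_list xs (Suc v) < k"
  proof (rule ccontr)
    assume "\<not> count_list xs v + count_list xs (Suc v) < k"
    then have le: "num_ge xs (Suc (Suc v)) + k \<le> num_ge xs v"
      using num_ge_Suc[of xs v] num_ge_Suc[of xs "Suc v"] by linarith
    \<comment> \<open>The first position whose part is at most v + 1.\<close>
    let ?t = "Suc (num_ge xs (Suc (Suc v)))"
    have idx: "?t \<in> part_indices xs" "?t + k - 1 \<in> part_indices xs"
      using le num_ge_le[of xs v] assms(2) by (auto simp: part_indices_iff)
    have "\<not> Suc (Suc v) \<le> part xs ?t" using le_num_ge_iff[OF assms(1) idx(1), of "Suc (Suc v)"] by simp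
    moreover have "v \<le> part xs (?t + k - 1)" using le_num_ge_iff[OF assms(1) idx(2), of v] le by simp
    ultimately have "part xs ?t - part xs (?t + k - 1) < 2" by linarith
    then show False using H idx by (meson not_less)
  qed
next
  fix t
  assume H: "\<forall>v>0. count_list xs v + count_list xs (Suc v) < k"
    and t: "t \<in> part_indices xs \<and> t + k - 1 \<in> part_indices xs"
  define v where "v = part xs (t + k - 1)"
  have "0 < v" using t assms(1) by (auto simp: v_def part_def part_indices_iff is_partition_def)
  then have lt: "num_ge xs v < num_ge xs (Suc (Suc v)) + k"
    using H[rule_format, of v] num_ge_Suc[of xs v] num_ge_Suc[of xs "Suc v"] by linarith
  have "t + k - 1 \<le> num_ge xs v"
    using le_num_ge_iff[OF assms(1), of "t + k - 1" v] t by (simp add: v_def)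
  then have "t \<le> num_ge xs (Suc (Suc v))" using lt by linarith
  then have "Suc (Suc v) \<le> part xs t" using le_num_ge_iff[OF assms(1), of t] t by simp
  then show "part xs t - part xs (t + k - 1) \<ge> 2" by (simp add: v_def)
qed

text \<open>Under \<open>lt\<close>, k - 1 consecutive parts that differ by at most 1 exhaust all
  parts of sizes v and v + 1, where v is the last of them. Hence v determines the window, and the
  multiplicities determine its sum.\<close>

lemma parity_condition_iff:
  assumes "is_partition xs" "2 \<le> k \<or> k = 1 \<and> d = 1"
    and lt: "\<And>v. 0 < v \<Longrightarrow> count_list xs v + count_list xs (Suc v) < k"
  shows "(\<forall>t. t \<in> part_indices xs \<and> t + k - 2 \<in> part_indices xs \<longrightarrow> part xs t - part xs (t + k - 2) \<le> 1 \<longrightarrow>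
      [(\<Sum>s = t..t + k - 2. part xs s) = e] (mod d)) \<longleftrightarrow>
    (\<forall>v>0. count_list xs v + count_list xs (Suc v) = k - 1 \<longrightarrow>
      [v * count_list xs v + Suc v * count_list xs (Suc v) = e] (mod d))"
proof (cases "2 \<le> k")
  case False
  then have "d = 1" using assms(2) by simp
  then show ?thesis by simp
next
  case k: True
  show ?thesis
  proof (intro iffI allI impI)
    fix v :: nat
    assume H: "\<forall>t. t \<in> part_indices xs \<and> t + k - 2 \<in> part_indices xs \<longrightarrow> part xs t - part xs (t + k - 2) \<le> 1 \<longrightarrow>
      [(\<Sum>s = t..t + k - 2. part xs s) = e] (mod d)"
      and v: "0 < v" "count_list xs v + count_list xs (Suc v) = k - 1"
    then have eq: "num_ge xs v = num_ge xs (Suc (Suc v)) + (k - 1)"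
      using num_ge_Suc[of xs v] num_ge_Suc[of xs "Suc v"] by linarith
    define t where "t = Suc (num_ge xs (Suc (Suc v)))"
    have tk: "t + k - 2 = num_ge xs v" using k eq by (simp add: t_def)
    have idx: "t \<in> part_indices xs" "t + k - 2 \<in> part_indices xs"
      using eq num_ge_le[of xs v] k unfolding tk by (auto simp: part_indices_iff t_def)
    have "\<not> Suc (Suc v) \<le> part xs t"
      using le_num_ge_iff[OF assms(1) idx(1), of "Suc (Suc v)"] by (simp add: t_def)
    moreover have "v \<le> part xs (t + k - 2)" using le_num_ge_iff[OF assms(1) idx(2), of v] tk by simp
    ultimately have "part xs t - part xs (t + k - 2) \<le> 1" by linarith
    then have "[(\<Sum>s = t..t + k - 2. part xs s) = e] (mod d)" using H idx by blast
    also have "{t..t + k - 2} = {num_ge xs (Suc (Suc v))<..num_ge xs v}"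
      unfolding tk by (auto simp: t_def)
    finally show "[v * count_list xs v + Suc v * count_list xs (Suc v) = e] (mod d)"
      by (simp only: sum_part_levels[OF assms(1)])
  next
    fix t
    assume H: "\<forall>v>0. count_list xs v + count_list xs (Suc v) = k - 1 \<longrightarrow>
      [v * count_list xs v + Suc v * count_list xs (Suc v) = e] (mod d)"
      and t: "t \<in> part_indices xs \<and> t + k - 2 \<in> part_indices xs" "part xs t - part xs (t + k - 2) \<le> 1"
    define v where "v = part xs (t + k - 2)"
    have v0: "0 < v" using t assms(1) by (auto simp: v_def part_def part_indices_iff is_partition_def)
    have g: "num_ge xs v = num_ge xs (Suc (Suc v)) + count_list xs (Suc v) + count_list xs v"
      using num_ge_Suc[of xs v] num_ge_Suc[of xs "Suc v"] by linarith
    have 1: "t + k - 2 \<le> num_ge xs v"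
      using le_num_ge_iff[OF assms(1), of "t + k - 2" v] t by (simp add: v_def)
    have "\<not> Suc (Suc v) \<le> part xs t" using t(2) by (simp add: v_def)
    then have 2: "\<not> t \<le> num_ge xs (Suc (Suc v))" using le_num_ge_iff[OF assms(1), of t] t by simp
    \<comment> \<open>By 1 and 2 the k - 1 positions of the window lie in a run that has at most k -
      1 positions by \<open>lt\<close>, so they fill it.\<close>
    have eq: "t = Suc (num_ge xs (Suc (Suc v)))" "count_list xs v + count_list xs (Suc v) = k - 1"
      "t + k - 2 = num_ge xs v"
      using 1 2 g lt[OF v0] k by linarith+
    have "{t..t + k - 2} = {num_ge xs (Suc (Suc v))<..num_ge xs v}"
      unfolding eq(3) by (auto simp: eq(1))
    then show "[(\<Sum>s = t..t + k - 2. part xs s) = e] (mod d)"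
      using H v0 eq(2) by (simp only: sum_part_levels[OF assms(1)])
  qed
qed

lemma difference_partitions_eq:
  assumes "j \<le> 1" "1 \<le> i" "i \<le> k + j - 1"
  shows "difference_partitions i k j n = {xs \<in> diff_parts k (2 - j) (i - 1) 0 i. sum_list xs = n}"
proof -
  have k: "1 \<le> k" "2 \<le> k \<or> k = 1 \<and> 2 - j = 1" using assms by linarith+
  have "xs \<in> difference_partitions i k j n \<longleftrightarrow> xs \<in> diff_parts k (2 - j) (i - 1) 0 i \<and> sum_list xs = n" for xs
  proof (cases "is_partition xs")
    case True
    have pos: "(\<forall>x\<in>set xs. 0 < x) = True" using True by (simp add: is_partition_def)
    have c: "count_list xs 1 \<le> i - 1 \<longleftrightarrow> count_list xs (Suc 0) < i" using assms(2) by auto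
    let ?lt = "\<forall>v>0. count_list xs v + count_list xs (Suc v) < k"
    let ?par = "\<forall>v>0. count_list xs v + count_list xs (Suc v) = k - 1 \<longrightarrow>
      [v * count_list xs v + Suc v * count_list xs (Suc v) = i - 1] (mod (2 - j))"
    let ?par' = "\<forall>t. t \<in> part_indices xs \<and> t + k - 2 \<in> part_indices xs \<longrightarrow>
      part xs t - part xs (t + k - 2) \<le> 1 \<longrightarrow> [(\<Sum>s = t..t + k - 2. part xs s) = i - 1] (mod (2 - j))"
    have "xs \<in> difference_partitions i k j n \<longleftrightarrow> sum_list xs = n \<and> count_list xs (Suc 0) < i \<and> ?lt \<and> ?par'"
      unfolding difference_partitions_def mem_Collect_eq difference_condition_iff[OF True k(1)] c
      by (simp only: True simp_thms)
    moreover have "xs \<in> diff_parts k (2 - j) (i - 1) 0 i \<longleftrightarrow> count_list xs (Suc 0) < i \<and> ?lt \<and> ?par"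
      unfolding diff_parts_def mem_Collect_eq admissible_def by (simp only: True pos simp_thms imp_conjR all_conj_distrib)
    moreover have "?lt \<Longrightarrow> ?par' \<longleftrightarrow> ?par"
      by (rule parity_condition_iff[OF True k(2)]) simp
    ultimately show ?thesis by argo
  qed (simp add: difference_partitions_def diff_parts_def)
  then show ?thesis by blast
qed

lemma congruence_partitions_eq:
  assumes "0 < i" "i < 2 * k + j"
  shows "congruence_partitions i k j n =
    {xs \<in> parts_above {m. m mod (2 * k + j) \<notin> {0, i, 2 * k + j - i}} 0. sum_list xs = n}"
proof -
  let ?N = "2 * k + j"
  have "[int p = - int i] (mod int ?N) \<longleftrightarrow> [int p = int (?N - i)] (mod int ?N)" for p
  proof -
    have "int (?N - i) = - int i + int ?N" using assms(2) by simp
    then have "[int (?N - i) = - int i] (mod int ?N)" by (simp only: cong_def mod_add_self2)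
    then show ?thesis using cong_sym cong_trans by blast
  qed
  then have *: "[int p = 0] (mod int ?N) \<longleftrightarrow> p mod ?N = 0" "[int p = int i] (mod int ?N) \<longleftrightarrow> p mod ?N = i"
     "[int p = - int i] (mod int ?N) \<longleftrightarrow> p mod ?N = ?N - i" for p
    using cong_int_iff[of p 0 ?N] cong_int_iff[of p i ?N] cong_int_iff[of p "?N - i" ?N] assms
    by (simp_all add: cong_def)
  show ?thesis
    unfolding congruence_partitions_def parts_above_def * by (auto simp: is_partition_def)
qed

section \<open>Partitions with a given word of nonzero residues\<close>

text \<open>The ascending list with gaps less than \<open>N\<close> and residues \<open>u\<close> that follows the number \<open>c + N * a\<close>:
  a descent in the residues forces a passage to the next multiple of \<open>N\<close>.\<close>

fun lift_word :: "nat \<Rightarrow> nat \<Rightarrow> nat \<Rightarrow> nat list \<Rightarrow> nat list" where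
  "lift_word N a c [] = []"
| "lift_word N a c (d # u) = (let a' = (if d < c then Suc a else a) in (d + N * a') # lift_word N a' d u)"

definition word_weight :: "nat \<Rightarrow> nat \<Rightarrow> nat list \<Rightarrow> nat" where
  "word_weight N a u = sum_list (lift_word N a 0 u)"

abbreviation wraps :: "nat \<Rightarrow> nat list \<Rightarrow> bool" where
  "wraps c u \<equiv> u \<noteq> [] \<and> hd u < c"

lemma lift_word_start: "lift_word N a c u = lift_word N (if wraps c u then Suc a else a) 0 u"
  by (cases u) auto

lemma word_weight_Nil [simp]: "word_weight N a [] = 0"
  by (simp add: word_weight_def)

lemma word_weight_Cons: "word_weight N a (c # u) = word_weight N (if wraps c u then Suc a else a) u + (c + N * a)"
  unfolding word_weight_def by (simp add: lift_word_start[of N a c u])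

definition zwords :: "nat \<Rightarrow> nat list \<Rightarrow> nat list set" where
  "zwords N w = {u. set u \<subseteq> {..<N} \<and> filter (\<lambda>c. c \<noteq> 0) u = w}"

text \<open>At level 0 a leading 0 would stand for the entry 0, which is no part and could be
  repeated without changing the weight.\<close>

definition nzwords :: "nat \<Rightarrow> nat list \<Rightarrow> nat list set" where
  "nzwords N w = {u \<in> zwords N w. u = [] \<or> hd u \<noteq> 0}"

lemma length_le_word_weight:
  "0 < N \<Longrightarrow> 0 < a \<or> u = [] \<or> hd u \<noteq> 0 \<Longrightarrow> length u \<le> word_weight N a u"
proof (induction u arbitrary: a)
  case (Cons c u)
  let ?a = "if wraps c u then Suc a else a"
  have "0 < ?a \<or> u = [] \<or> hd u \<noteq> 0" using Cons.prems by auto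
  from Cons.IH[OF Cons.prems(1) this] have "length u \<le> word_weight N ?a u" .
  moreover have "1 \<le> c + N * a" using Cons.prems by (auto simp: Suc_le_eq)
  ultimately show ?case unfolding word_weight_Cons by simp
qed simp

lemma finite_fibers_word_weight:
  assumes "0 < N" "\<And>u. u \<in> S \<Longrightarrow> set u \<subseteq> {..<N} \<and> (0 < a \<or> u = [] \<or> hd u \<noteq> 0)"
  shows "finite_fibers (word_weight N a) S"
  unfolding finite_fibers_def
proof
  fix n
  have "{u \<in> S. word_weight N a u = n} \<subseteq> {u. set u \<subseteq> {..<N} \<and> length u \<le> n}"
    using assms(2) length_le_word_weight[OF assms(1)] by blast
  then show "finite {u \<in> S. word_weight N a u = n}"
    by (rule finite_subset) (rule finite_lists_length_le, simp)
qed

lemma nzwords_Nil: "nzwords N [] = {[]}"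
proof -
  have "u = []" if "u \<in> nzwords N []" for u
    using that by (cases u) (auto simp: nzwords_def zwords_def split: if_splits)
  moreover have "[] \<in> nzwords N []" by (simp add: nzwords_def zwords_def)
  ultimately show ?thesis by blast
qed

lemma nzwords_Cons:
  assumes "0 < c" "c < N"
  shows "nzwords N (c # w) = (#) c ` zwords N w"
proof (intro equalityI subsetI)
  fix u assume "u \<in> nzwords N (c # w)"
  then show "u \<in> (#) c ` zwords N w"
    by (cases u) (auto simp: nzwords_def zwords_def split: if_splits)
qed (use assms in \<open>auto simp: nzwords_def zwords_def\<close>)

lemma zwords_split:
  assumes "0 < N"
  shows "zwords N w = (#) 0 ` zwords N w \<union> nzwords N w" "(#) 0 ` zwords N w \<inter> nzwords N w = {}"
proof -
  show "zwords N w = (#) 0 ` zwords N w \<union> nzwords N w"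
  proof (intro equalityI subsetI)
    fix u assume u: "u \<in> zwords N w"
    show "u \<in> (#) 0 ` zwords N w \<union> nzwords N w"
    proof (cases "u = [] \<or> hd u \<noteq> 0")
      case False
      then obtain u' where "u = 0 # u'" by (cases u) auto
      then show ?thesis using u by (auto simp: zwords_def)
    qed (use u in \<open>simp add: nzwords_def\<close>)
  qed (use assms in \<open>auto simp: nzwords_def zwords_def\<close>)
qed (auto simp: nzwords_def)

text \<open>A leading 0 costs N(a+1) and is never followed by a descent, so the rest is an arbitrary
  word at the same level: a geometric series.\<close>

lemma gf_zwords:
  assumes "0 < N"
  shows "(1 - fps_X ^ (N * Suc a)) * gf (word_weight N (Suc a)) (zwords N w) = gf (word_weight N (Suc a)) (nzwords N w)"
proof -
  let ?Z = "zwords N w" and ?C = "(#) 0 ` zwords N w" and ?A = "nzwords N w"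
  let ?g = "gf (word_weight N (Suc a))"
  have "finite_fibers (word_weight N (Suc a)) ?Z" using assms by (rule finite_fibers_word_weight) (simp add: zwords_def)
  moreover have "?C \<subseteq> ?Z" "?A \<subseteq> ?Z" using assms by (auto simp: zwords_def nzwords_def)
  ultimately have fin: "finite_fibers (word_weight N (Suc a)) ?C" "finite_fibers (word_weight N (Suc a)) ?A"
    by (auto intro: finite_fibers_subset)
  have "?g ?Z = ?g (?C \<union> ?A)" by (rule arg_cong[OF zwords_split(1)[OF assms]])
  also have "\<dots> = ?g ?C + ?g ?A" by (rule gf_Un[OF fin zwords_split(2)[OF assms]])
  also have "?g ?C = fps_X ^ (N * Suc a) * ?g ?Z"
    by (rule gf_shift) (auto simp: word_weight_Cons)
  finally have "?g ?Z = ?g ?A + fps_X ^ (N * Suc a) * ?g ?Z"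
    by (rule trans[OF _ add.commute])
  then have "?g ?Z - fps_X ^ (N * Suc a) * ?g ?Z = ?g ?A" by (rule diff_eq_eq[THEN iffD2])
  then show ?thesis by (simp only: left_diff_distrib mult_1)
qed

lemma hd_nzwords: "u \<in> nzwords N w \<Longrightarrow> wraps c u \<longleftrightarrow> wraps c w"
  by (cases u) (auto simp: nzwords_def zwords_def)

text \<open>After c > 0 a letter 0 is a descent and starts level a + 1. A nonzero next letter must
  be the first letter of w, so whether it is a descent depends on w alone.\<close>

lemma gf_nzwords_Cons:
  assumes "0 < c" "c < N"
  shows "gf (word_weight N a) (nzwords N (c # w)) = fps_X ^ (c + N * a) *
    (fps_X ^ (N * Suc a) * gf (word_weight N (Suc a)) (zwords N w) +
     gf (word_weight N (if wraps c w then Suc a else a)) (nzwords N w))"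
proof -
  have N: "0 < N" using assms by simp
  let ?wt = "\<lambda>u. word_weight N (if wraps c u then Suc a else a) u"
  let ?Z = "zwords N w" and ?C = "(#) 0 ` zwords N w" and ?A = "nzwords N w"
  have "finite_fibers ?wt ?Z"
    unfolding finite_fibers_def
  proof
    fix n
    have "{u \<in> ?Z. ?wt u = n} \<subseteq> {u \<in> ?Z. word_weight N (Suc a) u = n} \<union> {u \<in> ?A. word_weight N a u = n}"
      using assms(1) by (auto simp: nzwords_def)
    moreover have "finite_fibers (word_weight N (Suc a)) ?Z" using N by (rule finite_fibers_word_weight) (simp add: zwords_def)
    moreover have "finite_fibers (word_weight N a) ?A" using N by (rule finite_fibers_word_weight) (auto simp: nzwords_def zwords_def)
    ultimately show "finite {u \<in> ?Z. ?wt u = n}"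
      unfolding finite_fibers_def by (blast intro: finite_subset)
  qed
  moreover have "?C \<subseteq> ?Z" "?A \<subseteq> ?Z" using assms by (auto simp: zwords_def nzwords_def)
  ultimately have fin: "finite_fibers (?wt) ?C" "finite_fibers (?wt) ?A"
    by (auto intro: finite_fibers_subset)
  have "gf (word_weight N a) (nzwords N (c # w)) = fps_X ^ (c + N * a) * gf ?wt ?Z"
    unfolding nzwords_Cons[OF assms] by (rule gf_shift) (simp_all only: word_weight_Cons inj_on_Cons1)
  also have "gf ?wt ?Z = gf ?wt (?C \<union> ?A)" by (rule arg_cong[OF zwords_split(1)[OF N]])
  also have "\<dots> = gf ?wt ?C + gf ?wt ?A" by (rule gf_Un[OF fin zwords_split(2)[OF N]])
  also have "gf ?wt ?C = fps_X ^ (N * Suc a) * gf (word_weight N (Suc a)) ?Z"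
    using assms(1) by (intro gf_shift) (auto simp: word_weight_Cons)
  also have "gf ?wt ?A = gf (word_weight N (if wraps c w then Suc a else a)) ?A"
    unfolding gf_def by (simp add: hd_nzwords cong: conj_cong)
  finally show ?thesis .
qed

text \<open>The least sum of an ascending list with residue word \<open>w\<close>.\<close>

fun min_weight :: "nat \<Rightarrow> nat list \<Rightarrow> nat" where
  "min_weight N [] = 0"
| "min_weight N (c # w) = c + min_weight N w + (if wraps c w then N * length w else 0)"

text \<open>The product \<open>qblock N (length w) a\<close> starts at a + 1 because zeros inserted
  after a letter at level a contribute at least N(a+1) each.\<close>

lemma gf_nzwords:
  assumes "set w \<subseteq> {0<..<N}" "0 < N"
  shows "gf (word_weight N a) (nzwords N w) * qblock N (length w) a = fps_X ^ (min_weight N w + a * N * length w)"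
  using assms(1)
proof (induction w arbitrary: a)
  case Nil
  have "{x. x = [] \<and> word_weight N a x = n} = (if n = 0 then {[]} else {})" for n by auto
  then show ?case by (simp add: nzwords_Nil qblock_def gf_def fps_eq_iff)
next
  case (Cons c w)
  have c: "0 < c" "c < N" using Cons.prems by auto
  define s where "s = length w"
  define Z where "Z = gf (word_weight N (Suc a)) (zwords N w)"
  define A where "A = (\<lambda>a. gf (word_weight N a) (nzwords N w))"
  define x where "x = (fps_X ^ (N * Suc a) :: int fps)"
  have IH: "A b * qblock N s b = fps_X ^ (min_weight N w + b * N * s)" for b
    using Cons by (simp add: A_def s_def)
  have ZA: "(1 - x) * Z = A (Suc a)"
    unfolding Z_def A_def x_def by (rule gf_zwords[OF assms(2)])
  have kl: "qblock N (Suc s) a = (1 - x) * qblock N s (Suc a)"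
    unfolding x_def by (rule qblock_Suc_left)
  have kr: "qblock N (Suc s) a = qblock N s a * (1 - fps_X ^ (N * (a + s + 1)))"
    by (rule qblock_Suc_right)
  have Zk: "Z * qblock N (Suc s) a = A (Suc a) * qblock N s (Suc a)"
    unfolding kl ZA[symmetric] by (simp only: mult_ac)
  have eq: "gf (word_weight N a) (nzwords N (c # w)) = fps_X ^ (c + N * a) * (x * Z + A (if wraps c w then Suc a else a))"
    unfolding x_def Z_def A_def by (rule gf_nzwords_Cons[OF c])
  show ?case
  proof (cases "wraps c w")
    case True
    \<comment> \<open>With a descent from c to w, the rest starts at level a + 1 whether or not
      zeros come first, so the two cases recombine.\<close>
    have "x * Z + A (Suc a) = Z" unfolding ZA[symmetric] by (simp add: algebra_simps)
    then have "gf (word_weight N a) (nzwords N (c # w)) * qblock N (Suc s) a = fps_X ^ (c + N * a) * (Z * qblock N (Suc s) a)"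
      unfolding eq using True by (simp add: mult.assoc)
    also have "\<dots> = fps_X ^ (c + N * a) * fps_X ^ (min_weight N w + Suc a * N * s)"
      unfolding Zk IH ..
    also have "\<dots> = fps_X ^ (c + N * a + (min_weight N w + Suc a * N * s))" by (simp only: power_add)
    also have "c + N * a + (min_weight N w + Suc a * N * s) = min_weight N (c # w) + a * N * length (c # w)"
      using True by (simp add: s_def algebra_simps)
    finally show ?thesis by (simp add: s_def)
  next
    case False
    have e: "N * Suc a + (min_weight N w + Suc a * N * s) = min_weight N w + a * N * s + N * (a + s + 1)"
      by (simp add: algebra_simps)
    have "gf (word_weight N a) (nzwords N (c # w)) * qblock N (Suc s) a =
        fps_X ^ (c + N * a) * (x * (Z * qblock N (Suc s) a) + A a * qblock N (Suc s) a)"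
      unfolding eq if_not_P[OF False] by (simp only: distrib_left distrib_right mult_ac)
    also have "x * (Z * qblock N (Suc s) a) = fps_X ^ (min_weight N w + a * N * s + N * (a + s + 1))"
      unfolding Zk IH x_def power_add[symmetric] e ..
    also have "A a * qblock N (Suc s) a = fps_X ^ (min_weight N w + a * N * s) * (1 - fps_X ^ (N * (a + s + 1)))"
      unfolding kr IH[symmetric] by (simp only: mult_ac)
    \<comment> \<open>The words with a zero after c supply exactly the term missing from 1 -
      q^(N(a+s+1)).\<close>
    also have "fps_X ^ (min_weight N w + a * N * s + N * (a + s + 1)) + \<dots> = (fps_X ^ (min_weight N w + a * N * s) :: int fps)"
      unfolding power_add[of _ "min_weight N w + a * N * s"] by (simp only: right_diff_distrib mult_1_right) simp
    also have "fps_X ^ (c + N * a) * \<dots> = fps_X ^ (c + N * a + (min_weight N w + a * N * s))"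
      by (simp only: power_add)
    also have "c + N * a + (min_weight N w + a * N * s) = min_weight N (c # w) + a * N * length (c # w)"
      using False by (auto simp: s_def algebra_simps)
    finally show ?thesis by (simp add: s_def)
  qed
qed

section \<open>Ascending lists with a given residue word\<close>

definition rwords :: "nat \<Rightarrow> nat list \<Rightarrow> nat list set" where
  "rwords N w = {ys. sorted ys \<and> map (\<lambda>y. y mod N) ys = w}"

lemma map_add_rwords:
  assumes "0 < N"
  shows "map (\<lambda>y. y + N) ` rwords N w = {ys \<in> rwords N w. \<forall>y\<in>set ys. N \<le> y}"
proof (intro equalityI subsetI)
  fix ys assume ys: "ys \<in> {ys \<in> rwords N w. \<forall>y\<in>set ys. N \<le> y}"
  then have "ys = map (\<lambda>y. y + N) (map (\<lambda>y. y - N) ys)" by (simp add: map_idI)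
  moreover have "map (\<lambda>y. y - N) ys \<in> rwords N w"
  proof -
    have "sorted (map (\<lambda>y. y - N) ys)" using ys
      by (auto simp: rwords_def sorted_iff_nth_mono intro: diff_le_mono)
    moreover have "map (\<lambda>y. y mod N) (map (\<lambda>y. y - N) ys) = map (\<lambda>y. y mod N) ys"
      using ys by (auto simp: le_mod_geq)
    moreover have "map (\<lambda>y. y mod N) ys = w" using ys by (simp add: rwords_def)
    ultimately show ?thesis unfolding rwords_def mem_Collect_eq by (simp only: simp_thms)
  qed
  ultimately show "ys \<in> map (\<lambda>y. y + N) ` rwords N w" by blast
qed (auto simp: rwords_def sorted_wrt_map)

text \<open>Only the first entry matters. If its residue is below c, being at least c means being at
  least N; otherwise the bound c holds automatically.\<close>

lemma rwords_ge:
  assumes "0 < c" "c < N" "set w \<subseteq> {0<..<N}"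
  shows "{ys \<in> rwords N w. \<forall>y\<in>set ys. c \<le> y} =
    (if wraps c w then map (\<lambda>y. y + N) ` rwords N w else rwords N w)"
proof (cases "wraps c w")
  case True
  have "N \<le> y" if "sorted (z # ys)" "z mod N < c" "c \<le> z" "y \<in> set (z # ys)" for z y :: nat and ys
  proof -
    have "N \<le> z" using that(2,3) by (metis mod_less not_le)
    then show ?thesis using that(1,4) by auto
  qed
  then have "N \<le> y" if "ys \<in> rwords N w" "\<forall>y\<in>set ys. c \<le> y" "y \<in> set ys" for ys y
    using that True by (cases ys) (auto simp: rwords_def)
  then show ?thesis using True assms by (auto simp: map_add_rwords)
next
  case False
  have "c \<le> y" if "ys \<in> rwords N w" "y \<in> set ys" for ys y
  proof (cases ys)
    case (Cons z zs)
    then have "c \<le> z mod N" using that False by (auto simp: rwords_def)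
    then have "c \<le> z" using mod_less_eq_dividend le_trans by blast
    then show ?thesis using that Cons by (auto simp: rwords_def)
  qed (use that in simp)
  then show ?thesis using False by auto
qed

lemma finite_fibers_rwords: "set w \<subseteq> {0<..<N} \<Longrightarrow> S \<subseteq> rwords N w \<Longrightarrow> finite_fibers sum_list S"
proof (rule finite_fibers_lists)
  fix ys assume *: "set w \<subseteq> {0<..<N}" "S \<subseteq> rwords N w" "ys \<in> S"
  then have "map (\<lambda>y. y mod N) ys = w" by (auto simp: rwords_def)
  then have "set w = (\<lambda>y. y mod N) ` set ys" by auto
  then have "0 < y" if "y \<in> set ys" for y using * that by (cases y) auto
  then show "(\<forall>x\<in>set ys. 0 < x) \<and> sum_list ys \<le> sum_list ys" by simp
qed

lemma sum_list_map_add: "sum_list (map (\<lambda>y. y + b) ys) = sum_list ys + b * length (ys :: nat list)"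
  by (induction ys) auto

lemma length_rwords: "ys \<in> rwords N w \<Longrightarrow> length ys = length w"
  by (auto simp: rwords_def)

lemma gf_rwords_shift:
  "gf sum_list (map (\<lambda>y. y + N) ` rwords N w) = fps_X ^ (N * length w) * gf sum_list (rwords N w)"
  by (rule gf_shift) (auto simp: sum_list_map_add length_rwords inj_on_def)

text \<open>The first entry is c or at least N, and in the latter case N can be subtracted from
  every entry without changing order or residues.\<close>

lemma rwords_Cons:
  assumes "set (c # w) \<subseteq> {0<..<N}"
  shows "rwords N (c # w) = map (\<lambda>y. y + N) ` rwords N (c # w) \<union> (#) c ` {ys \<in> rwords N w. \<forall>y\<in>set ys. c \<le> y}"
    and "map (\<lambda>y. y + N) ` rwords N (c # w) \<inter> (#) c ` {ys \<in> rwords N w. \<forall>y\<in>set ys. c \<le> y} = {}"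
proof -
  have c: "0 < c" "c < N" using assms by auto
  then have N: "0 < N" by simp
  show "rwords N (c # w) = map (\<lambda>y. y + N) ` rwords N (c # w) \<union> (#) c ` {ys \<in> rwords N w. \<forall>y\<in>set ys. c \<le> y}"
    (is "_ = _ \<union> ?C")
  proof (intro equalityI subsetI)
    fix ys assume ys: "ys \<in> rwords N (c # w)"
    then obtain z zs where z: "ys = z # zs" "z mod N = c" "sorted ys" "map (\<lambda>y. y mod N) zs = w"
      by (cases ys) (auto simp: rwords_def)
    show "ys \<in> map (\<lambda>y. y + N) ` rwords N (c # w) \<union> ?C"
    proof (cases "N \<le> z")
      case True
      then have "\<forall>y\<in>set ys. N \<le> y" using z by auto
      then show ?thesis unfolding map_add_rwords[OF N] using ys by blast
    next
      case False
      then have "z = c" using z by simp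
      then show ?thesis using z by (auto simp: rwords_def)
    qed
  next
    fix ys assume "ys \<in> map (\<lambda>y. y + N) ` rwords N (c # w) \<union> ?C"
    then show "ys \<in> rwords N (c # w)"
      unfolding map_add_rwords[OF N] using c by (auto simp: rwords_def)
  qed
  show "map (\<lambda>y. y + N) ` rwords N (c # w) \<inter> ?C = {}"
    unfolding map_add_rwords[OF N] using c by auto
qed

lemma gf_rwords:
  assumes "set w \<subseteq> {0<..<N}"
  shows "gf sum_list (rwords N w) * qblock N (length w) 0 = fps_X ^ min_weight N w"
  using assms
proof (induction w)
  case Nil
  have "{x. x = ([] :: nat list) \<and> sum_list x = n} = (if n = 0 then {[]} else {})" for n by auto
  moreover have "rwords N [] = {[]}" by (auto simp: rwords_def)
  ultimately show ?case by (simp add: qblock_def gf_def fps_eq_iff)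
next
  case (Cons c w)
  have c: "0 < c" "c < N" "set w \<subseteq> {0<..<N}" using Cons.prems by auto
  let ?R = "rwords N (c # w)" and ?S = "map (\<lambda>y. y + N) ` rwords N (c # w)"
    and ?C = "(#) c ` {ys \<in> rwords N w. \<forall>y\<in>set ys. c \<le> y}"
  define x where "x = (fps_X ^ (N * (0 + length w + 1)) :: int fps)"
  have len: "length (c # w) = Suc (length w)" by simp
  have kr: "qblock N (Suc (length w)) 0 = qblock N (length w) 0 * (1 - x)"
    unfolding x_def by (rule qblock_Suc_right)
  have "gf sum_list ?R = gf sum_list (?S \<union> ?C)" by (rule arg_cong[OF rwords_Cons(1)[OF Cons.prems]])
  also have "\<dots> = gf sum_list ?S + gf sum_list ?C"
    using rwords_Cons(1)[OF Cons.prems]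
    by (intro gf_Un rwords_Cons(2) finite_fibers_rwords[OF Cons.prems] Cons.prems) blast+
  also have "gf sum_list ?S = x * gf sum_list ?R"
    unfolding gf_rwords_shift x_def by simp
  also have "gf sum_list ?C = fps_X ^ c * gf sum_list {ys \<in> rwords N w. \<forall>y\<in>set ys. c \<le> y}"
    by (rule gf_shift) auto
  also have "gf sum_list {ys \<in> rwords N w. \<forall>y\<in>set ys. c \<le> y} =
      fps_X ^ (if wraps c w then N * length w else 0) * gf sum_list (rwords N w)"
    unfolding rwords_ge[OF c] using gf_rwords_shift[of N w] by simp
  finally have step: "(1 - x) * gf sum_list ?R = fps_X ^ c * (fps_X ^ (if wraps c w then N * length w else 0) * gf sum_list (rwords N w))"
    unfolding left_diff_distrib mult_1 by (rule diff_eq_eq[THEN iffD2, OF trans[OF _ add.commute]])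
  have "gf sum_list ?R * qblock N (length (c # w)) 0 = ((1 - x) * gf sum_list ?R) * qblock N (length w) 0"
    unfolding len kr by (simp only: mult_ac)
  also have "\<dots> = fps_X ^ c * (fps_X ^ (if wraps c w then N * length w else 0) *
      (gf sum_list (rwords N w) * qblock N (length w) 0))"
    unfolding step by (simp only: mult_ac)
  also have "\<dots> = fps_X ^ min_weight N (c # w)"
    unfolding Cons.IH[OF c(3)] min_weight.simps by (simp only: power_add mult_ac)
  finally show ?case .
qed

lemma card_nzwords_eq_rwords:
  assumes "set w \<subseteq> {0<..<N}" "0 < N"
  shows "card {u \<in> nzwords N w. word_weight N 0 u = n} = card {ys \<in> rwords N w. sum_list ys = n}"
proof -
  have "eq_upto 0 (qblock N (length w) 0) 1"
    unfolding qblock_def using assms(2) by (intro eq_upto_prod_1) auto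
  then have "qblock N (length w) 0 \<noteq> 0" by (auto simp: eq_upto_iff)
  moreover have "gf (word_weight N 0) (nzwords N w) * qblock N (length w) 0 = gf sum_list (rwords N w) * qblock N (length w) 0"
    using gf_nzwords[OF assms, of 0] gf_rwords[OF assms(1)] by simp
  ultimately have "gf (word_weight N 0) (nzwords N w) = gf sum_list (rwords N w)" by simp
  from arg_cong[OF this, of "\<lambda>f. fps_nth f n"] show ?thesis by (simp add: gf_def)
qed

section \<open>Weighted partitions\<close>

text \<open>Equal parts occupy consecutive positions, so M copies of v exist exactly when two
  positions at distance M - 1 carry v.\<close>

lemma weighted_condition_iff:
  assumes "is_partition xs" "1 \<le> M"
  shows "(\<forall>t. t \<in> part_indices xs \<and> t + M - 1 \<in> part_indices xs \<longrightarrow> part xs t - part xs (t + M - 1) \<ge> 1) \<longleftrightarrow>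
    (\<forall>v>0. count_list xs v < M)"
proof (intro iffI allI impI)
  fix v :: nat
  assume H: "\<forall>t. t \<in> part_indices xs \<and> t + M - 1 \<in> part_indices xs \<longrightarrow> part xs t - part xs (t + M - 1) \<ge> 1"
  show "count_list xs v < M"
  proof (rule ccontr)
    assume "\<not> count_list xs v < M"
    then have le: "num_ge xs (Suc v) + M \<le> num_ge xs v" using num_ge_Suc[of xs v] by linarith
    let ?t = "Suc (num_ge xs (Suc v))"
    have idx: "?t \<in> part_indices xs" "?t + M - 1 \<in> part_indices xs"
      using le num_ge_le[of xs v] assms(2) by (auto simp: part_indices_iff)
    have "\<not> Suc v \<le> part xs ?t" using le_num_ge_iff[OF assms(1) idx(1), of "Suc v"] by simp
    moreover have "v \<le> part xs (?t + M - 1)" using le_num_ge_iff[OF assms(1) idx(2), of v] le by simp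
    ultimately have "part xs ?t - part xs (?t + M - 1) < 1" by linarith
    then show False using H idx by (meson not_less)
  qed
next
  fix t
  assume H: "\<forall>v>0. count_list xs v < M"
    and t: "t \<in> part_indices xs \<and> t + M - 1 \<in> part_indices xs"
  define v where "v = part xs (t + M - 1)"
  have "0 < v" using t assms(1) by (auto simp: v_def part_def part_indices_iff is_partition_def)
  then have lt: "num_ge xs v < num_ge xs (Suc v) + M"
    using H[rule_format, of v] num_ge_Suc[of xs v] by linarith
  have "t + M - 1 \<le> num_ge xs v"
    using le_num_ge_iff[OF assms(1), of "t + M - 1" v] t by (simp add: v_def)
  then have "t \<le> num_ge xs (Suc v)" using lt by linarith
  then have "Suc v \<le> part xs t" using le_num_ge_iff[OF assms(1), of t] t by simp
  then show "part xs t - part xs (t + M - 1) \<ge> 1" by (simp add: v_def)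
qed

section \<open>Conjugation of partitions with bounded multiplicities\<close>

definition reg_parts :: "nat \<Rightarrow> nat list set" where
  "reg_parts M = {xs. is_partition xs \<and> (\<forall>v>0. count_list xs v < M)}"

fun flat :: "nat \<Rightarrow> nat \<Rightarrow> nat list \<Rightarrow> bool" where
  "flat M h [] \<longleftrightarrow> True"
| "flat M h (y # ys) \<longleftrightarrow> h \<le> y \<and> y < h + M \<and> flat M y ys"

text \<open>Column lengths of the partitions in \<open>reg_parts M\<close>, smallest first: the
  multiplicity of a part is the gap between neighbouring column lengths. Starting from 0 also bounds
  the smallest column, which gives the multiplicity of the largest part.\<close>

definition flat_lists :: "nat \<Rightarrow> nat list set" where
  "flat_lists M = {ys. flat M 0 ys \<and> 0 \<notin> set ys}"

lemma flat_snoc: "flat M h (ys @ [y]) \<longleftrightarrow> flat M h ys \<and> last (h # ys) \<le> y \<and> y < last (h # ys) + M"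
  by (induction ys arbitrary: h) auto

text \<open>Conjugation, with columns inserted in ascending order: a new column of length m raises
  all existing parts by 1 and appends ones up to length m.\<close>

definition conj_parts :: "nat list \<Rightarrow> nat list" where
  "conj_parts = foldl (\<lambda>xs m. map Suc xs @ replicate (m - length xs) 1) []"

lemma conj_parts_Nil [simp]: "conj_parts [] = []"
  by (simp add: conj_parts_def)

lemma conj_parts_snoc:
  "conj_parts (ys @ [y]) = map Suc (conj_parts ys) @ replicate (y - length (conj_parts ys)) 1"
  by (simp add: conj_parts_def)

lemma flat_lists_snoc:
  "ys @ [y] \<in> flat_lists M \<longleftrightarrow> ys \<in> flat_lists M \<and> 0 < y \<and> last (0 # ys) \<le> y \<and> y < last (0 # ys) + M"
  unfolding flat_lists_def mem_Collect_eq flat_snoc by auto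

lemma length_conj_parts: "ys \<in> flat_lists M \<Longrightarrow> length (conj_parts ys) = last (0 # ys)"
  by (induction ys rule: rev_induct) (auto simp: flat_lists_snoc conj_parts_snoc split: if_splits)

lemma count_list_map_Suc: "count_list (map Suc xs) v = (if v = 0 then 0 else count_list xs (v - 1))"
  by (induction xs) auto

lemma is_partition_conj_step:
  "is_partition (map Suc xs @ replicate c 1) \<longleftrightarrow> sorted_wrt (\<ge>) xs"
  unfolding is_partition_append using is_partition_replicate[of 1 c]
  by (auto simp: is_partition_def sorted_wrt_map)

lemma conj_parts_in: "0 < M \<Longrightarrow> ys \<in> flat_lists M \<Longrightarrow> conj_parts ys \<in> reg_parts M"
proof (induction ys rule: rev_induct)
  case Nil
  then show ?case by (simp add: reg_parts_def is_partition_def)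
next
  case (snoc y ys)
  let ?l = "conj_parts ys"
  have M: "0 < M" and ys: "ys \<in> flat_lists M" and y: "y < last (0 # ys) + M" "last (0 # ys) \<le> y"
    using snoc.prems by (simp_all add: flat_lists_snoc)
  have c: "y - length ?l < M" using y unfolding length_conj_parts[OF ys] by linarith
  have l: "is_partition ?l" "\<forall>v>0. count_list ?l v < M"
    using snoc.IH[OF M ys] by (simp_all add: reg_parts_def)
  have "count_list ?l 0 = 0" using l(1) by (auto simp: is_partition_def count_list_0_iff)
  then have "count_list (map Suc ?l @ replicate (y - length ?l) 1) v < M" if "0 < v" for v
    using that c l(2) by (cases "v = 1") (auto simp: count_list_map_Suc count_list_replicate_same)
  moreover have "is_partition (map Suc ?l @ replicate (y - length ?l) 1)"
    unfolding is_partition_conj_step using l(1) by (simp add: is_partition_def)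
  ultimately show ?case unfolding conj_parts_snoc reg_parts_def by blast
qed

lemma sum_part_indices:
  "(\<Sum>t\<in>part_indices xs. w t * part xs t) = (\<Sum>p<length xs. w (Suc p) * xs ! p)"
  unfolding part_indices_def
  by (rule sum.reindex_bij_witness[of _ Suc "\<lambda>t. t - 1"]) (auto simp: part_def)

text \<open>A column of length m adds 1 to each of the first m parts, hence contributes the first m
  weights.\<close>

lemma weight_conj_parts:
  fixes w :: "nat \<Rightarrow> nat"
  assumes "ys \<in> flat_lists M"
  shows "(\<Sum>t\<in>part_indices (conj_parts ys). w t * part (conj_parts ys) t) =
    sum_list (map (\<lambda>m. \<Sum>p<m. w (Suc p)) ys)"
  unfolding sum_part_indices using assms
proof (induction ys rule: rev_induct)
  case (snoc y ys)
  let ?l = "conj_parts ys"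
  have ys: "ys \<in> flat_lists M" and y: "length ?l \<le> y"
    using snoc.prems length_conj_parts[of ys M] by (simp_all only: flat_lists_snoc)
  define c where "c = y - length ?l"
  have yc: "y = length ?l + c" using y by (simp add: c_def)
  let ?L = "map Suc ?l @ replicate c 1"
  have "(\<Sum>p<length ?L. w (Suc p) * ?L ! p) = (\<Sum>p<length ?l + c. w (Suc p) * ?L ! p)" by simp
  also have "\<dots> = (\<Sum>p<length ?l. w (Suc p) * ?L ! p) + (\<Sum>p<c. w (Suc (length ?l + p)) * ?L ! (length ?l + p))"
    by (rule sum_lessThan_add)
  also have "(\<Sum>p<length ?l. w (Suc p) * ?L ! p) = (\<Sum>p<length ?l. w (Suc p) * ?l ! p + w (Suc p))"
    by (rule sum.cong) (auto simp: nth_append)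
  also have "(\<Sum>p<c. w (Suc (length ?l + p)) * ?L ! (length ?l + p)) = (\<Sum>p<c. w (Suc (length ?l + p)))"
    by (rule sum.cong) (auto simp: nth_append)
  also have "(\<Sum>p<length ?l. w (Suc p) * ?l ! p + w (Suc p)) + \<dots> =
      (\<Sum>p<length ?l. w (Suc p) * ?l ! p) + (\<Sum>p<y. w (Suc p))"
    unfolding yc sum_lessThan_add by (simp add: sum.distrib)
  finally show ?case
    using snoc.IH[OF ys] unfolding conj_parts_snoc c_def[symmetric] by simp
qed simp

text \<open>The last entry is the length of the image, and the parts above 1, lowered by 1, are the
  image of the remaining list.\<close>

lemma conj_parts_inj:
  assumes "0 < M"
  shows "inj_on conj_parts (flat_lists M)"
proof (rule inj_onI)
  fix ys zs
  assume "ys \<in> flat_lists M" "zs \<in> flat_lists M" "conj_parts ys = conj_parts zs"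
  then show "ys = zs"
  proof (induction ys arbitrary: zs rule: rev_induct)
    case Nil
    show ?case
    proof (cases zs rule: rev_cases)
      case (snoc zs' z)
      then show ?thesis using Nil length_conj_parts[of zs M] by (simp add: flat_lists_snoc)
    qed simp
  next
    case (snoc y ys)
    have y: "length (conj_parts (ys @ [y])) = y" "0 < y" "ys \<in> flat_lists M"
      using length_conj_parts[OF snoc.prems(1)] snoc.prems(1) by (simp_all add: flat_lists_snoc)
    then obtain zs' z where zs: "zs = zs' @ [z]" using snoc.prems(3) by (cases zs rule: rev_cases) auto
    have z: "length (conj_parts zs) = z" "zs' \<in> flat_lists M"
      using length_conj_parts[OF snoc.prems(2)] snoc.prems(2) by (simp_all add: zs flat_lists_snoc)
    have "0 \<notin> set (conj_parts ys)" "0 \<notin> set (conj_parts zs')"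
      using conj_parts_in[OF assms y(3)] conj_parts_in[OF assms z(2)] by (auto simp: reg_parts_def is_partition_def)
    then have "filter (\<lambda>x. 1 < x) (conj_parts (ys @ [y])) = map Suc (conj_parts ys)"
      "filter (\<lambda>x. 1 < x) (conj_parts zs) = map Suc (conj_parts zs')"
      unfolding zs conj_parts_snoc by (auto simp: filter_id_conv intro!: gr0I)
    then have "map Suc (conj_parts ys) = map Suc (conj_parts zs')" using snoc.prems(3) by simp
    then have "ys = zs'" using snoc.IH[OF y(3) z(2)] by simp
    moreover have "y = length (conj_parts (ys @ [y]))" by (rule y(1)[symmetric])
    then have "y = z" unfolding snoc.prems(3) z(1) .
    ultimately show ?case by (simp add: zs)
  qed
qed

text \<open>Induction by removing the longest column: every part is lowered by 1, and the ones
  disappear.\<close>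

lemma conj_parts_surj: "xs \<in> reg_parts M \<Longrightarrow> xs \<in> conj_parts ` flat_lists M"
proof (induction "sum_list xs" arbitrary: xs rule: less_induct)
  case less
  show ?case
  proof (cases "xs = []")
    case True
    then show ?thesis by (auto simp: flat_lists_def intro!: image_eqI[of _ _ "[]"])
  next
    case False
    have part: "is_partition xs" "\<forall>v>0. count_list xs v < M" using less.prems by (auto simp: reg_parts_def)
    define c where "c = count_list xs 1"
    define fs where "fs = filter (\<lambda>x. Suc 0 < x) xs"
    define zs where "zs = map (\<lambda>x. x - 1) fs"
    have fs: "map Suc zs = fs" unfolding zs_def fs_def map_map by (rule map_idI) auto
    have xs: "xs = map Suc zs @ replicate c 1"
      using is_partition_split[of xs 0] part(1) unfolding fs fs_def c_def by (simp add: is_partition_def)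
    have pos: "0 < x" if "x \<in> set zs" for x using that by (auto simp: zs_def fs_def)
    have "is_partition zs" using part(1) pos unfolding xs is_partition_conj_step by (simp add: is_partition_def)
    moreover have "count_list zs v < M" if "0 < v" for v
    proof -
      have "count_list xs (Suc v) = count_list zs v"
        using that by (simp add: xs count_list_map_Suc count_list_replicate_same)
      then show ?thesis using part(2) by (metis zero_less_Suc)
    qed
    ultimately have "zs \<in> reg_parts M" by (simp add: reg_parts_def)
    moreover have "sum_list zs < sum_list xs"
    proof -
      have "sum_list (map Suc zs) = sum_list zs + length zs" by (induction zs) auto
      then have "sum_list xs = sum_list zs + length xs" by (simp add: xs sum_list_replicate)
      then show ?thesis using False by simp
    qed
    ultimately obtain ys where ys: "ys \<in> flat_lists M" "zs = conj_parts ys" using less.hyps by blast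
    have len: "length xs = last (0 # ys) + c" using length_conj_parts[OF ys(1)] ys(2) by (simp add: xs)
    have "c < M" using part(2) by (simp add: c_def)
    moreover have "0 < length xs" using False by simp
    ultimately have "ys @ [length xs] \<in> flat_lists M"
      unfolding flat_lists_snoc using ys(1) len by (intro conjI) simp_all
    moreover have "conj_parts (ys @ [length xs]) = xs"
      unfolding conj_parts_snoc ys(2)[symmetric] by (subst (2) xs) (simp add: xs)
    ultimately show ?thesis by (metis image_eqI)
  qed
qed

section \<open>Lists with small gaps encoded by their residues\<close>

definition residue_words :: "nat set \<Rightarrow> nat list set" where
  "residue_words T = {u. set u \<subseteq> T \<and> (u = [] \<or> hd u \<noteq> 0)}"

lemma flat_lift_word: "c < M \<Longrightarrow> set u \<subseteq> {..<M} \<Longrightarrow> flat M (c + M * a) (lift_word M a c u)"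
  by (induction M a c u rule: lift_word.induct) (auto simp: Let_def)

lemma flat_ge: "flat M h ys \<Longrightarrow> y \<in> set ys \<Longrightarrow> h \<le> y"
  by (induction ys arbitrary: h) fastforce+

lemma map_mod_lift_word: "set u \<subseteq> {..<M} \<Longrightarrow> map (\<lambda>y. y mod M) (lift_word M a c u) = u"
  by (induction M a c u rule: lift_word.induct) (auto simp: Let_def)

text \<open>A gap below M leaves only the quotients a and a + 1, and comparing the two residues
  decides between them.\<close>

lemma lift_word_map_mod: "flat M (c + M * a) ys \<Longrightarrow> c < M \<Longrightarrow> lift_word M a c (map (\<lambda>y. y mod M) ys) = ys"
proof (induction ys arbitrary: a c)
  case (Cons y ys)
  define d where "d = y mod M"
  define q where "q = y div M"
  have y: "y = d + M * q" by (simp add: d_def q_def)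
  have d: "d < M" using Cons.prems(2) by (simp add: d_def)
  have b: "c + M * a \<le> y" "y < c + M * a + M" and f: "flat M y ys" using Cons.prems(1) by auto
  have "q = (if d < c then Suc a else a)"
  proof -
    have "q < Suc (Suc a)"
    proof (rule ccontr)
      assume "\<not> q < Suc (Suc a)"
      then have "M * Suc (Suc a) \<le> M * q" by (intro mult_le_mono2) simp
      then show False using b y Cons.prems(2) by simp
    qed
    moreover have "a \<le> q"
    proof (rule ccontr)
      assume "\<not> a \<le> q"
      then have "M * Suc q \<le> M * a" by (intro mult_le_mono2) simp
      then show False using b y d by simp
    qed
    ultimately have "q = a \<or> q = Suc a" by linarith
    then show ?thesis using b y by auto
  qed
  then have "lift_word M a c (map (\<lambda>y. y mod M) (y # ys)) = (d + M * q) # lift_word M q d (map (\<lambda>y. y mod M) ys)"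
    by (simp add: d_def[symmetric] Let_def)
  also have "lift_word M q d (map (\<lambda>y. y mod M) ys) = ys"
    using f d unfolding y by (rule Cons.IH)
  finally show ?case using y by simp
qed simp

lemma bij_betw_lift_word: assumes "0 < M"
  shows "bij_betw (lift_word M 0 0) (residue_words {..<M}) (flat_lists M)"
proof (rule bij_betw_byWitness[where f' = "map (\<lambda>y. y mod M)"])
  show "\<forall>u\<in>residue_words {..<M}. map (\<lambda>y. y mod M) (lift_word M 0 0 u) = u"
    by (simp add: residue_words_def map_mod_lift_word)
  show "\<forall>ys\<in>flat_lists M. lift_word M 0 0 (map (\<lambda>y. y mod M) ys) = ys"
    using lift_word_map_mod[of M 0 0] assms by (simp add: flat_lists_def)
  show "lift_word M 0 0 ` residue_words {..<M} \<subseteq> flat_lists M"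
  proof (rule image_subsetI)
    fix u assume u: "u \<in> residue_words {..<M}"
    then have f: "flat M 0 (lift_word M 0 0 u)" using flat_lift_word[of 0 M u 0] assms by (simp add: residue_words_def)
    moreover have "0 < y" if "y \<in> set (lift_word M 0 0 u)" for y
    proof (cases u)
      case (Cons d u')
      then have "lift_word M 0 0 u = d # lift_word M 0 d u'" "0 < d" using u by (auto simp: residue_words_def)
      then show ?thesis using f that flat_ge[of M d "lift_word M 0 d u'" y] by auto
    qed (use that in simp)
    ultimately show "lift_word M 0 0 u \<in> flat_lists M" by (auto simp: flat_lists_def)
  qed
  show "map (\<lambda>y. y mod M) ` flat_lists M \<subseteq> residue_words {..<M}"
  proof (rule image_subsetI)
    fix ys assume "ys \<in> flat_lists M"
    then show "map (\<lambda>y. y mod M) ys \<in> residue_words {..<M}"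
      using assms by (cases ys) (auto simp: residue_words_def flat_lists_def)
  qed
qed

section \<open>Partial sums of the weights\<close>

lemma sum_of_bool_cong:
  assumes "1 \<le> c" "c \<le> M"
  shows "(\<Sum>p<m. of_bool ([Suc p = c] (mod M))) = (m + (M - c)) div M"
proof (induction m)
  case 0
  then show ?case using assms by simp
next
  case (Suc m)
  have "[Suc m = c] (mod M) \<longleftrightarrow> [Suc m + (M - c) = c + (M - c)] (mod M)"
    by (simp only: cong_add_rcancel_nat)
  also have "\<dots> \<longleftrightarrow> (Suc m + (M - c)) mod M = 0"
    using assms by (simp add: cong_def)
  finally have *: "[Suc m = c] (mod M) \<longleftrightarrow> Suc (m + (M - c)) mod M = 0" by simp
  show ?case unfolding sum.lessThan_Suc Suc * add_Suc div_Suc by simp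
qed

text \<open>A closed form of the sum of the first m weights: the two quotients count the t <= m in
  the classes of i and of M + 1 - i, as \<open>wsum_sum\<close> shows.\<close>

definition wsum :: "nat \<Rightarrow> nat \<Rightarrow> nat \<Rightarrow> nat" where
  "wsum M i m = m + (m + (M - i)) div M + (m + (i - 1)) div M"

lemma wsum_sum:
  assumes "1 \<le> i" "i \<le> M"
  shows "(\<Sum>p<m. 1 + of_bool ([Suc p = i] (mod M)) + of_bool ([Suc p = Suc M - i] (mod M))) = wsum M i m"
proof -
  have e: "M - (Suc M - i) = i - 1" "1 \<le> Suc M - i" "Suc M - i \<le> M" using assms by auto
  show ?thesis
    unfolding sum.distrib sum_of_bool_cong[OF assms] sum_of_bool_cong[OF e(2,3)] e(1) wsum_def by simp
qed

text \<open>A period of M indices meets each of the two classes once, so its weights add up to M +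
  2, which is the modulus N.\<close>

lemma wsum_period:
  assumes "1 \<le> i" "i \<le> M"
  shows "wsum M i (m + M * a) = wsum M i m + (M + 2) * a"
proof -
  have *: "(m + M * a + b) div M = (m + b) div M + a" for b
    using assms by (metis add.assoc add.commute div_mult_self2 le_zero_eq not_one_le_zero)
  show ?thesis unfolding wsum_def * by (simp add: algebra_simps)
qed

text \<open>The extra weights make the values jump over i and over M + 2 - i = N - i, which are
  precisely the excluded residues. For 2i = M + 1 both are skipped in one jump.\<close>

lemma wsum_less:
  assumes "1 \<le> i" "2 * i < M + 2" "m < M"
  shows "wsum M i m = (if m < i then m else if m < M + 1 - i then m + 1 else m + 2)"
proof -
  have 1: "(m + (M - i)) div M = (if m < i then 0 else 1)" if "i \<le> M"
    using assms that by (auto intro: div_nat_eqI)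
  have 2: "(m + (i - 1)) div M = (if m < M + 1 - i then 0 else 1)" if "i \<le> M"
    using assms that by (auto intro: div_nat_eqI)
  have "i \<le> M" using assms by linarith
  with 1 2 show ?thesis using assms(2) unfolding wsum_def by (auto split: if_splits)
qed

lemma wsum_bij:
  assumes "1 \<le> i" "2 * i < M + 2"
  shows "bij_betw (wsum M i) {..<M} ({..<M + 2} - {i, M + 2 - i})"
proof (rule bij_betw_byWitness[where f' = "\<lambda>y. if y < i then y else if y < M + 2 - i then y - 1 else y - 2"])
qed (use assms in \<open>auto simp: wsum_less split: if_splits\<close>)

lemma wsum_less_iff:
  assumes "1 \<le> i" "2 * i < M + 2" "x < M" "y < M"
  shows "wsum M i x < wsum M i y \<longleftrightarrow> x < y"
  using assms by (simp add: wsum_less)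

text \<open>\<open>wsum\<close> is strictly increasing on residues, so descents are preserved, and a
  period M becomes a period M + 2.\<close>

lemma map_wsum_lift_word:
  assumes "1 \<le> i" "2 * i < M + 2" "c < M" "set u \<subseteq> {..<M}"
  shows "map (wsum M i) (lift_word M a c u) = lift_word (M + 2) a (wsum M i c) (map (wsum M i) u)"
  using assms(3,4)
proof (induction u arbitrary: a c)
  case (Cons d u)
  have d: "d < M" "i \<le> M" using Cons.prems assms by auto
  show ?case
    using Cons.IH[of d] Cons.prems d assms wsum_less_iff[OF assms(1,2) d(1) Cons.prems(1)]
    by (simp add: Let_def wsum_period)
qed simp

lemma map_bij_residue_words:
  assumes "bij_betw f S T" "\<And>x. x \<in> S \<Longrightarrow> f x = 0 \<longleftrightarrow> x = (0::nat)"
  shows "bij_betw (map f) (residue_words S) (residue_words T)"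
proof (rule bij_betw_byWitness[where f' = "map (inv_into S f)"])
  have inv: "\<And>x. x \<in> S \<Longrightarrow> inv_into S f (f x) = x" "\<And>y. y \<in> T \<Longrightarrow> f (inv_into S f y) = y"
    and into: "\<And>x. x \<in> S \<Longrightarrow> f x \<in> T" "\<And>y. y \<in> T \<Longrightarrow> inv_into S f y \<in> S"
    using assms(1) by (auto simp: bij_betw_def f_inv_into_f inv_into_into)
  show "\<forall>u\<in>residue_words S. map (inv_into S f) (map f u) = u"
    using inv(1) by (auto simp: residue_words_def intro!: map_idI)
  show "\<forall>u\<in>residue_words T. map f (map (inv_into S f) u) = u"
    using inv(2) by (auto simp: residue_words_def intro!: map_idI)
  show "map f ` residue_words S \<subseteq> residue_words T"
  proof (rule image_subsetI)
    fix u assume "u \<in> residue_words S"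
    then show "map f u \<in> residue_words T"
      using into(1) assms(2) by (cases u) (auto simp: residue_words_def)
  qed
  show "map (inv_into S f) ` residue_words T \<subseteq> residue_words S"
  proof (rule image_subsetI)
    fix u assume "u \<in> residue_words T"
    then show "map (inv_into S f) u \<in> residue_words S"
      using into(2) assms(2)[OF into(2)] inv(2) by (cases u) (auto simp: residue_words_def)
  qed
qed

lemma eqpoll_weighted:
  assumes "1 \<le> i" "2 * i < M + 2" "1 \<le> M"
  defines "w \<equiv> \<lambda>t. 1 + of_bool ([t = i] (mod M)) + of_bool ([t = Suc M - i] (mod M)) :: nat"
  shows "{xs \<in> reg_parts M. (\<Sum>t\<in>part_indices xs. w t * part xs t) = n} \<approx>
    {u \<in> residue_words ({..<M + 2} - {i, M + 2 - i}). word_weight (M + 2) 0 u = n}"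
proof -
  let ?T = "{..<M + 2} - {i, M + 2 - i}"
  let ?wt = "\<lambda>xs. \<Sum>t\<in>part_indices xs. w t * part xs t"
  let ?h = "\<lambda>u. conj_parts (lift_word M 0 0 u)"
  have M: "0 < M" "i \<le> M" using assms by auto
  have lift_word: "bij_betw (lift_word M 0 0) (residue_words {..<M}) (flat_lists M)" using M(1) by (rule bij_betw_lift_word)
  have conj: "bij_betw conj_parts (flat_lists M) (reg_parts M)"
    using conj_parts_inj[OF M(1)] conj_parts_in[OF M(1)] conj_parts_surj
    unfolding bij_betw_def by blast
  have h: "bij_betw ?h (residue_words {..<M}) (reg_parts M)"
    using bij_betw_trans[OF lift_word conj] by (simp add: comp_def)
  have z: "wsum M i x = 0 \<longleftrightarrow> x = 0" if "x \<in> {..<M}" for x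
    using that assms by (auto simp: wsum_less)
  have m: "bij_betw (map (wsum M i)) (residue_words {..<M}) (residue_words ?T)"
    using wsum_bij[OF assms(1,2)] z by (rule map_bij_residue_words)
  have wt: "?wt (?h u) = word_weight (M + 2) 0 (map (wsum M i) u)" if u: "u \<in> residue_words {..<M}" for u
  proof -
    have "lift_word M 0 0 u \<in> flat_lists M" using u lift_word by (auto simp: bij_betw_def)
    then have "?wt (?h u) = sum_list (map (\<lambda>m. \<Sum>p<m. w (Suc p)) (lift_word M 0 0 u))"
      by (rule weight_conj_parts)
    also have "(\<lambda>m. \<Sum>p<m. w (Suc p)) = wsum M i"
      using wsum_sum[OF assms(1) M(2)] by (simp add: w_def)
    also have "map (wsum M i) (lift_word M 0 0 u) = lift_word (M + 2) 0 (wsum M i 0) (map (wsum M i) u)"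
      using u M by (intro map_wsum_lift_word assms) (auto simp: residue_words_def)
    also have "wsum M i 0 = 0" using z[of 0] M by simp
    finally show ?thesis by (simp add: word_weight_def)
  qed
  have "bij_betw ?h {u \<in> residue_words {..<M}. word_weight (M + 2) 0 (map (wsum M i) u) = n} {xs \<in> reg_parts M. ?wt xs = n}"
    using h wt by (rule_tac bij_betw_Collect) auto
  moreover have "bij_betw (map (wsum M i)) {u \<in> residue_words {..<M}. word_weight (M + 2) 0 (map (wsum M i) u) = n}
      {u \<in> residue_words ?T. word_weight (M + 2) 0 u = n}"
    using m by (rule bij_betw_Collect) simp
  ultimately show ?thesis by (meson eqpoll_def eqpoll_sym eqpoll_trans)
qed

section \<open>Assembling the equinumerous sets\<close>

lemma rev_parts_above:
  assumes "0 < N" "0 \<notin> T"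
  shows "rev ` {xs \<in> parts_above {m. m mod N \<in> T} 0. sum_list xs = n} =
    {ys. sorted ys \<and> (\<forall>y\<in>set ys. y mod N \<in> T) \<and> sum_list ys = n}"
proof (intro equalityI subsetI)
  fix ys assume ys: "ys \<in> {ys. sorted ys \<and> (\<forall>y\<in>set ys. y mod N \<in> T) \<and> sum_list ys = n}"
  then have "0 < y" if "y \<in> set ys" for y using that assms by (cases y) auto
  then have "rev ys \<in> {xs \<in> parts_above {m. m mod N \<in> T} 0. sum_list xs = n}"
    using ys by (auto simp: parts_above_def is_partition_def sorted_wrt_rev sum_list_rev)
  then show "ys \<in> rev ` {xs \<in> parts_above {m. m mod N \<in> T} 0. sum_list xs = n}"
    by (metis image_eqI rev_rev_ident)
qed (auto simp: parts_above_def is_partition_def sorted_wrt_rev sum_list_rev)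

text \<open>Both sets are cut into fibres over the word w of nonzero residues, where
  \<open>card_nzwords_eq_rwords\<close> applies. Reversal accounts for \<open>rwords\<close> being
  ascending.\<close>

lemma card_residue_words_eq:
  assumes "T \<subseteq> {..<N}" "0 \<in> T" "0 < N"
  shows "card {u \<in> residue_words T. word_weight N 0 u = n} = card {xs \<in> parts_above {m. m mod N \<in> T - {0}} 0. sum_list xs = n}"
proof -
  \<comment> \<open>All entries involved are at least 1, so only words of length at most n matter,
    and the index set of the unions is finite.\<close>
  define W where "W = {w. set w \<subseteq> T - {0} \<and> length w \<le> n}"
  have finT: "finite (T - {0})" using assms(1) finite_subset by blast
  then have finW: "finite W" unfolding W_def by (rule finite_lists_length_le)
  let ?A = "\<lambda>w. {u \<in> nzwords N w. word_weight N 0 u = n}" and ?B = "\<lambda>w. {ys \<in> rwords N w. sum_list ys = n}"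
  have A: "{u \<in> residue_words T. word_weight N 0 u = n} = (\<Union>w\<in>W. ?A w)"
  proof (intro equalityI subsetI)
    fix u assume u: "u \<in> {u \<in> residue_words T. word_weight N 0 u = n}"
    let ?w = "filter (\<lambda>c. c \<noteq> 0) u"
    have "length u \<le> n" using u length_le_word_weight[OF assms(3), of 0 u] by (auto simp: residue_words_def)
    then have "length ?w \<le> n" using length_filter_le le_trans by blast
    then have "?w \<in> W" using u by (auto simp: W_def residue_words_def)
    moreover have "u \<in> ?A ?w" using u assms(1) by (auto simp: residue_words_def nzwords_def zwords_def)
    ultimately show "u \<in> (\<Union>w\<in>W. ?A w)" by blast
  next
    fix u assume "u \<in> (\<Union>w\<in>W. ?A w)"
    then obtain w where w: "w \<in> W" "u \<in> ?A w" by blast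
    have "x \<in> T" if "x \<in> set u" for x
    proof (cases "x = 0")
      case False
      then have "x \<in> set w" using w(2) that by (auto simp: nzwords_def zwords_def)
      then show ?thesis using w(1) by (auto simp: W_def)
    qed (use assms(2) in simp)
    then show "u \<in> {u \<in> residue_words T. word_weight N 0 u = n}" using w by (auto simp: nzwords_def residue_words_def)
  qed
  have B: "{ys. sorted ys \<and> (\<forall>y\<in>set ys. y mod N \<in> T - {0}) \<and> sum_list ys = n} = (\<Union>w\<in>W. ?B w)"
  proof (intro equalityI subsetI)
    fix ys assume ys: "ys \<in> {ys. sorted ys \<and> (\<forall>y\<in>set ys. y mod N \<in> T - {0}) \<and> sum_list ys = n}"
    have "\<forall>y\<in>set ys. 0 < y" using ys by (auto intro!: gr0I)
    then have "length ys \<le> n" using ys length_le_sum_list by auto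
    then have "map (\<lambda>y. y mod N) ys \<in> W" using ys by (auto simp: W_def)
    moreover have "ys \<in> ?B (map (\<lambda>y. y mod N) ys)" using ys by (simp add: rwords_def)
    ultimately show "ys \<in> (\<Union>w\<in>W. ?B w)" by blast
  next
    fix ys assume "ys \<in> (\<Union>w\<in>W. ?B w)"
    then show "ys \<in> {ys. sorted ys \<and> (\<forall>y\<in>set ys. y mod N \<in> T - {0}) \<and> sum_list ys = n}"
      by (auto simp: rwords_def W_def)
  qed
  have w: "set w \<subseteq> {0<..<N}" if "w \<in> W" for w
  proof
    fix x assume "x \<in> set w"
    then have "x \<in> T" "x \<noteq> 0" using that by (auto simp: W_def)
    then show "x \<in> {0<..<N}" using assms(1) by auto
  qed
  have finA: "finite (?A w)" if "w \<in> W" for w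
  proof -
    have "finite_fibers (word_weight N 0) (nzwords N w)"
      using assms(3) by (rule finite_fibers_word_weight) (auto simp: nzwords_def zwords_def)
    then show ?thesis by (simp add: finite_fibers_def)
  qed
  have finB: "finite (?B w)" if "w \<in> W" for w
    using finite_fibers_rwords[OF w[OF that] subset_refl] by (simp add: finite_fibers_def)
  have "card {u \<in> residue_words T. word_weight N 0 u = n} = (\<Sum>w\<in>W. card (?A w))"
    unfolding A using finW finA by (intro card_UN_disjoint) (auto simp: nzwords_def zwords_def)
  also have "\<dots> = (\<Sum>w\<in>W. card (?B w))"
    using w card_nzwords_eq_rwords[OF _ assms(3)] by (intro sum.cong) auto
  also have "\<dots> = card {ys. sorted ys \<and> (\<forall>y\<in>set ys. y mod N \<in> T - {0}) \<and> sum_list ys = n}"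
    unfolding B using finW finB by (intro card_UN_disjoint[symmetric]) (auto simp: rwords_def)
  also have "\<dots> = card (rev ` {xs \<in> parts_above {m. m mod N \<in> T - {0}} 0. sum_list xs = n})"
    using rev_parts_above[OF assms(3), of "T - {0}" n] by simp
  also have "\<dots> = card {xs \<in> parts_above {m. m mod N \<in> T - {0}} 0. sum_list xs = n}"
    by (rule card_image) (rule inj_onI, simp)
  finally show ?thesis .
qed

lemma finite_partitions: "finite {xs. is_partition xs \<and> sum_list xs = n}"
  by (rule finite_subset[OF _ finite_lists_sum[of n]]) (auto simp: is_partition_def)

lemma weighted_partitions_eq:
  assumes "1 \<le> i" "3 \<le> 2 * k + j"
  defines "M \<equiv> 2 * k + j - 2"
  shows "weighted_partitions i k j n = {xs \<in> reg_parts M.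
    (\<Sum>t\<in>part_indices xs. (1 + of_bool ([t = i] (mod M)) + of_bool ([t = Suc M - i] (mod M))) * part xs t) = n}"
proof -
  have e: "t + 2 * k + j - 3 = t + M - 1" "2 * k + j - i - 1 = Suc M - i" "1 \<le> M" for t
    using assms by auto
  have "xs \<in> weighted_partitions i k j n \<longleftrightarrow> xs \<in> reg_parts M \<and>
    (\<Sum>t\<in>part_indices xs. (1 + of_bool ([t = i] (mod M)) + of_bool ([t = Suc M - i] (mod M))) * part xs t) = n" for xs
  proof (cases "is_partition xs")
    case True
    show ?thesis
      unfolding weighted_partitions_def reg_parts_def mem_Collect_eq e M_def[symmetric]
        weighted_condition_iff[OF True e(3)] by (auto simp: True)
  qed (simp add: weighted_partitions_def reg_parts_def)
  then show ?thesis by blast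
qed

theorem theorem1p20:
  fixes i k j n :: nat
  assumes "j \<in> {0, 1}" and "1 \<le> i" and "i \<le> k + j - 1"
  shows "congruence_partitions i k j n \<approx> difference_partitions i k j n \<and>
         difference_partitions i k j n \<approx> weighted_partitions i k j n"
proof -
  define N where "N = 2 * k + j"
  define M where "M = N - 2"
  define A where "A = {xs \<in> parts_above {m. m mod N \<notin> {0, i, N - i}} 0. sum_list xs = n}"
  define D where "D = {xs \<in> diff_parts k (2 - j) (i - 1) 0 i. sum_list xs = n}"
  \<comment> \<open>The link between the first and third sets: residue words of lists with gaps
    below N that avoid the classes of i and -i but may contain multiples of N.\<close>
  define U where "U = {u \<in> residue_words ({..<N} - {i, N - i}). word_weight N 0 u = n}"
  have j: "j \<le> 1" using assms(1) by auto
  have N: "2 * i < N" "3 \<le> N" "N = M + 2" "1 \<le> M" using assms j by (auto simp: N_def M_def)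
  have A: "congruence_partitions i k j n = A"
    unfolding A_def N_def using assms N by (intro congruence_partitions_eq) (auto simp: N_def)
  have D: "difference_partitions i k j n = D"
    unfolding D_def using j assms by (intro difference_partitions_eq)
  have "A \<subseteq> {xs. is_partition xs \<and> sum_list xs = n}" "D \<subseteq> {xs. is_partition xs \<and> sum_list xs = n}"
    by (auto simp: A_def D_def parts_above_def diff_parts_def)
  then have fin: "finite A" "finite D" using finite_partitions finite_subset by blast+
  have "card D = card A"
    using arg_cong[OF gf_diff_parts_eq_parts_above[OF j assms(2,3)], of "\<lambda>f. fps_nth f n"]
    by (simp add: gf_def A_def D_def N_def)
  then have AD: "A \<approx> D" using fin by (simp add: eqpoll_iff_card)
  have "{m. m mod N \<in> {..<N} - {i, N - i} - {0}} = {m. m mod N \<notin> {0, i, N - i}}"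
    using N by auto
  then have "card U = card A"
    unfolding U_def A_def using card_residue_words_eq[of "{..<N} - {i, N - i}" N n] N assms(2) by simp
  moreover have "finite U"
  proof -
    have "finite_fibers (word_weight N 0) (residue_words ({..<N} - {i, N - i}))"
      using N by (intro finite_fibers_word_weight) (auto simp: residue_words_def)
    then show ?thesis by (simp add: finite_fibers_def U_def)
  qed
  ultimately have "A \<approx> U" using fin by (simp add: eqpoll_iff_card)
  moreover have "weighted_partitions i k j n \<approx> U"
  proof -
    have "M = 2 * k + j - 2" by (simp add: M_def N_def)
    then have W: "weighted_partitions i k j n = {xs \<in> reg_parts M.
        (\<Sum>t\<in>part_indices xs. (1 + of_bool ([t = i] (mod M)) + of_bool ([t = Suc M - i] (mod M))) * part xs t) = n}"
      using weighted_partitions_eq[of i k j n] N(2) assms(2) by (simp only: N_def)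
    have "2 * i < M + 2" using N by simp
    then show ?thesis
      unfolding W U_def N(3) using eqpoll_weighted[OF assms(2) _ N(4)] by simp
  qed
  ultimately have "D \<approx> weighted_partitions i k j n"
    using AD by (meson eqpoll_sym eqpoll_trans)
  then show ?thesis using AD by (simp add: A D)
qed

end
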